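(* Let $2\le d_1\le d_2$ be integers, let $d_3=d_1+d_2$, and let $A=\Bbbk[x_1,x_2,x_3]/(x_1^{d_1},x_2^{d_2},x_3^{d_3})$ be the corresponding Artinian monomial complete intersection. Then the non-Lefschetz locus of conics $\mathcal{C}_A$ has codimension $1$ in $\mathbb{P}^5$.
   Context: $\Bbbk$ is an algebraically closed field of characteristic $0$ and $R=\Bbbk[x_1,x_2,x_3]$ with the standard grading. Let $h_i=\dim_\Bbbk[A]_i$ and let $e$ be the socle degree of $A$. Let $S=\Bbbk[a_1,\dots,a_6]$ be the coordinate ring of $\mathbb{P}^5=\mathbb{P}([R]_2)$, with $a_1,\dots,a_6$ the coefficients of a generic quadratic form $C$. For each $i$, multiplication $\times C:S\otimes_\Bbbk[A]_i\to S\otimes_\Bbbk[A]_{i+2}$ is represented by an $h_{i+2}\times h_i$ matrix of linear forms in $S$; let $I(\mathcal{C}_{A,i})$ be the ideal of its maximal minors. $\mathcal{C}_A\subseteq\mathbb{P}^5$ is the subscheme defined by $I(\mathcal{C}_A)=\bigcap_{0\le i\le e-2}I(\mathcal{C}_{A,i})$; its points are the quadratic forms $C$ for which $\times C:[A]_i\to[A]_{i+2}$ is neither injective nor surjective for some $i$. *)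

theory Defs
  imports
    "HOL-Library.Poly_Mapping"
    "HOL-Library.Numeral_Type"
    "HOL-Library.Extended_Nat"
    "HOL-Analysis.Abstract_Topology"
    "HOL-Algebra.Algebraic_Closure_Type"
    "HOL-Algebra.QuotRing"
    "HOL-Algebra.Embedded_Algebras"
    "Jordan_Normal_Form.Determinant"
    "Jordan_Normal_Form.DL_Submatrix"
begin

section \<open>Polynomial rings\<close>

text \<open>
  A polynomial is a finitely supported map from exponent vectors to coefficients. The variables
  of \<open>R = k[x1,x2,x3]\<close> and \<open>S = k[a1,...,a6]\<close> are indexed by the
  numeral types 3 and 6, so that \<open>Var 1, Var 2, Var 3 :: (3, 'k) mpol\<close> are the three distinct
  variables of \<open>R\<close> (in the type 3 the numeral 3 denotes the same element as 0).
\<close>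

type_synonym ('v, 'a) mpol = "('v \<Rightarrow>\<^sub>0 nat) \<Rightarrow>\<^sub>0 'a"

definition Var :: "'v \<Rightarrow> ('v, 'a::comm_ring_1) mpol" where
  "Var v = Poly_Mapping.single (Poly_Mapping.single v 1) 1"

definition Const :: "'a \<Rightarrow> ('v, 'a::comm_ring_1) mpol" where
  "Const c = Poly_Mapping.single 0 c"

definition mdeg :: "('v::finite \<Rightarrow>\<^sub>0 nat) \<Rightarrow> nat" where
  "mdeg m = (\<Sum>v\<in>UNIV. Poly_Mapping.lookup m v)"

definition homogeneous :: "nat \<Rightarrow> ('v::finite, 'a::comm_ring_1) mpol \<Rightarrow> bool" where
  "homogeneous n f \<longleftrightarrow> (\<forall>m\<in>Poly_Mapping.keys f. mdeg m = n)"

definition hom_part :: "nat \<Rightarrow> ('v::finite, 'a::comm_ring_1) mpol \<Rightarrow> ('v, 'a) mpol" where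
  "hom_part n f =
     (\<Sum>m\<in>{m \<in> Poly_Mapping.keys f. mdeg m = n}. Poly_Mapping.single m (Poly_Mapping.lookup f m))"

abbreviation typ_ring :: "'a::comm_ring_1 ring" where
  "typ_ring \<equiv> ring_of_type_algebra"

definition ideal_gen :: "'a::comm_ring_1 set \<Rightarrow> 'a set" where
  "ideal_gen G = Idl\<^bsub>typ_ring\<^esub> G"


section \<open>Projective space and codimension\<close>

definition homogeneous_ideal :: "('v::finite, 'a::comm_ring_1) mpol set \<Rightarrow> bool" where
  "homogeneous_ideal I \<longleftrightarrow> ideal I typ_ring \<and> (\<forall>f\<in>I. \<forall>n. hom_part n f \<in> I)"

text \<open>The points of Proj: homogeneous primes not containing the irrelevant ideal.\<close>

definition proj_points :: "('v::finite, 'a::comm_ring_1) mpol set set" where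
  "proj_points = {P. primeideal P typ_ring \<and> homogeneous_ideal P \<and> \<not> range Var \<subseteq> P}"

text \<open>
  The generating set \<open>T\<close> need not consist of homogeneous elements; a homogeneous prime contains
  \<open>T\<close> iff it contains all homogeneous components of its elements.
\<close>

definition vanishing_set ::
    "('v::finite, 'a::comm_ring_1) mpol set \<Rightarrow> ('v, 'a) mpol set set" where
  "vanishing_set T = {P \<in> proj_points. T \<subseteq> P}"

definition proj_topology :: "('v::finite, 'a::comm_ring_1) mpol set topology" where
  "proj_topology = topology (\<lambda>U. \<exists>T. U = proj_points - vanishing_set T)"

lemma vanishing_set_Un:
  "vanishing_set T \<union> vanishing_set T' = vanishing_set {f * g |f g. f \<in> T \<and> g \<in> T'}"
proof (intro equalityI subsetI)
  fix P assume "P \<in> vanishing_set T \<union> vanishing_set T'"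
  then have P: "P \<in> proj_points" "T \<subseteq> P \<or> T' \<subseteq> P" by (auto simp: vanishing_set_def)
  then interpret primeideal P typ_ring by (simp add: proj_points_def)
  have "f * g \<in> P" if "f \<in> T" "g \<in> T'" for f g
    using P(2) that I_l_closed[of g f] I_r_closed[of f g]
    by (auto simp: ring_of_type_algebra_def)
  then show "P \<in> vanishing_set {f * g |f g. f \<in> T \<and> g \<in> T'}"
    using P(1) by (auto simp: vanishing_set_def)
next
  fix P assume P: "P \<in> vanishing_set {f * g |f g. f \<in> T \<and> g \<in> T'}"
  then interpret primeideal P typ_ring by (simp add: proj_points_def vanishing_set_def)
  have *: "f \<in> P \<or> g \<in> P" if "f \<in> T" "g \<in> T'" for f g
    using P that I_prime[of f g] by (auto simp: vanishing_set_def ring_of_type_algebra_def)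
  show "P \<in> vanishing_set T \<union> vanishing_set T'"
    using P * by (auto simp: vanishing_set_def)
qed

lemma istopology_proj:
  "istopology (\<lambda>U. \<exists>T. U = (proj_points :: ('v::finite, 'a::comm_ring_1) mpol set set) - vanishing_set T)"
proof (unfold istopology_def, intro conjI allI impI)
  fix U V :: "('v, 'a) mpol set set"
  assume "\<exists>T. U = proj_points - vanishing_set T" "\<exists>T. V = proj_points - vanishing_set T"
  then obtain T T' where "U = proj_points - vanishing_set T" "V = proj_points - vanishing_set T'"
    by auto
  then have "U \<inter> V = proj_points - vanishing_set {f * g |f g. f \<in> T \<and> g \<in> T'}"
    by (simp add: vanishing_set_Un[symmetric] Diff_Un)
  then show "\<exists>T. U \<inter> V = proj_points - vanishing_set T" by blast
next
  fix \<K> :: "('v, 'a) mpol set set set"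
  assume "\<forall>K\<in>\<K>. \<exists>T. K = proj_points - vanishing_set T"
  then obtain T where T: "\<And>K. K \<in> \<K> \<Longrightarrow> K = proj_points - vanishing_set (T K)" by metis
  have "\<Union>\<K> = (\<Union>K\<in>\<K>. proj_points - vanishing_set (T K))" using T by auto
  also have "\<dots> = proj_points - vanishing_set (\<Union>K\<in>\<K>. T K)"
    by (auto simp: vanishing_set_def)
  finally show "\<exists>T. \<Union>\<K> = proj_points - vanishing_set T" by blast
qed

lemma openin_proj: "openin proj_topology U \<longleftrightarrow> (\<exists>T. U = proj_points - vanishing_set T)"
  unfolding proj_topology_def topology_inverse'[OF istopology_proj] ..

lemma topspace_proj:
  "topspace proj_topology = (proj_points :: ('v::finite, 'a::comm_ring_1) mpol set set)"
proof -
  have "openin proj_topology (proj_points :: ('v, 'a) mpol set set)"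
  proof -
    have "vanishing_set {1} = ({} :: ('v, 'a) mpol set set)"
    proof -
      have False if "primeideal P typ_ring" "1 \<in> P" for P :: "('v, 'a) mpol set"
      proof -
        interpret primeideal P typ_ring by fact
        show False using one_imp_carrier I_notcarr that(2) by (auto simp: ring_of_type_algebra_def)
      qed
      then show ?thesis by (auto simp: vanishing_set_def proj_points_def)
    qed
    then show ?thesis unfolding openin_proj by (metis Diff_empty)
  qed
  then have "proj_points \<subseteq> topspace (proj_topology :: ('v, 'a) mpol set topology)"
    by (rule openin_subset)
  moreover have "topspace (proj_topology :: ('v, 'a) mpol set topology) \<subseteq> proj_points"
    using openin_topspace[of "proj_topology :: ('v, 'a) mpol set topology"]
    unfolding openin_proj by blast
  ultimately show ?thesis by (rule equalityI[rotated])
qed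

lemma closedin_proj: "closedin proj_topology Y \<longleftrightarrow> (\<exists>T. Y = vanishing_set T)"
proof
  assume "closedin proj_topology Y"
  then obtain T where "Y \<subseteq> proj_points" "proj_points - Y = proj_points - vanishing_set T"
    by (auto simp: closedin_def topspace_proj openin_proj)
  moreover have "vanishing_set T \<subseteq> proj_points" by (auto simp: vanishing_set_def)
  ultimately have "Y = vanishing_set T" by blast
  then show "\<exists>T. Y = vanishing_set T" ..
next
  assume "\<exists>T. Y = vanishing_set T"
  then show "closedin proj_topology Y"
    by (auto simp: closedin_def topspace_proj openin_proj vanishing_set_def)
qed

definition irreducible_closed :: "'p topology \<Rightarrow> 'p set \<Rightarrow> bool" where
  "irreducible_closed \<X> Z \<longleftrightarrow> closedin \<X> Z \<and> Z \<noteq> {} \<and>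
     (\<forall>F G. closedin \<X> F \<longrightarrow> closedin \<X> G \<longrightarrow> Z \<subseteq> F \<union> G \<longrightarrow> Z \<subseteq> F \<or> Z \<subseteq> G)"

definition codim_irreducible :: "'p topology \<Rightarrow> 'p set \<Rightarrow> enat" where
  "codim_irreducible \<X> Z = Sup {enat n |n. \<exists>Zs :: nat \<Rightarrow> 'p set. Zs 0 = Z \<and>
     (\<forall>i\<le>n. irreducible_closed \<X> (Zs i)) \<and> (\<forall>i<n. Zs i \<subset> Zs (Suc i))}"

text \<open>The empty set gets codimension \<open>\<infinity>\<close>.\<close>

definition codimension :: "'p topology \<Rightarrow> 'p set \<Rightarrow> enat" where
  "codimension \<X> Y = Inf {codim_irreducible \<X> Z |Z. Z \<subseteq> Y \<and> irreducible_closed \<X> Z}"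


section \<open>The graded algebra A = R/J\<close>

definition quot_alg :: "(3, 'k::field) mpol set \<Rightarrow> (3, 'k) mpol set ring" where
  "quot_alg J = typ_ring Quot J"

definition residue_class :: "'a::comm_ring_1 set \<Rightarrow> 'a \<Rightarrow> 'a set" where
  "residue_class J f = J +>\<^bsub>typ_ring\<^esub> f"

definition graded_piece :: "(3, 'k::field) mpol set \<Rightarrow> nat \<Rightarrow> (3, 'k) mpol set set" where
  "graded_piece J i = residue_class J ` {f. homogeneous i f}"

definition scalars :: "(3, 'k::field) mpol set \<Rightarrow> (3, 'k) mpol set set" where
  "scalars J = range (\<lambda>c. residue_class J (Const c))"

text \<open>For an Artinian graded quotient the socle degree is the largest degree of a nonzero piece.\<close>

definition socle_degree :: "(3, 'k::field) mpol set \<Rightarrow> nat" where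
  "socle_degree J = (GREATEST i. graded_piece J i \<noteq> {\<zero>\<^bsub>quot_alg J\<^esub>})"

text \<open>\<open>bs\<close> lists forms of degree \<open>i\<close> whose classes are a \<open>k\<close>-basis of \<open>[A]_i\<close>.\<close>

definition basis_of_piece ::
    "(3, 'k::field) mpol set \<Rightarrow> nat \<Rightarrow> (3, 'k) mpol list \<Rightarrow> bool" where
  "basis_of_piece J i bs \<longleftrightarrow>
     (\<forall>b\<in>set bs. homogeneous i b) \<and>
     ring.independent (quot_alg J) (scalars J) (map (residue_class J) bs) \<and>
     ring.Span (quot_alg J) (scalars J) (map (residue_class J) bs) = graded_piece J i"


section \<open>The non-Lefschetz locus of conics\<close>

text \<open>
  \<open>S \<otimes> R\<close> is \<open>S[x1,x2,x3]\<close>, and \<open>S \<otimes> A\<close> is its quotient by the extension of \<open>J\<close>.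
\<close>

definition lift_coeffs :: "(3, 'k::field) mpol \<Rightarrow> (3, (6, 'k) mpol) mpol" where
  "lift_coeffs f = Poly_Mapping.map Const f"

definition extended_ideal :: "(3, 'k::field) mpol set \<Rightarrow> (3, (6, 'k) mpol) mpol set" where
  "extended_ideal J = ideal_gen (lift_coeffs ` J)"

definition generic_conic :: "(3, (6, 'k::field) mpol) mpol" where
  "generic_conic =
     Const (Var 1) * (Var 1 * Var 1) + Const (Var 2) * (Var 1 * Var 2) +
     Const (Var 3) * (Var 1 * Var 3) + Const (Var 4) * (Var 2 * Var 2) +
     Const (Var 5) * (Var 2 * Var 3) + Const (Var 6) * (Var 3 * Var 3)"

text \<open>
  \<open>M\<close> is the matrix over \<open>S\<close>, with respect to the bases \<open>bs\<close> of \<open>[A]_i\<close> and \<open>cs\<close> of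
  \<open>[A]_(i+2)\<close>, of multiplication by the generic conic; as \<open>cs\<close> is an \<open>S\<close>-basis of
  \<open>S \<otimes> [A]_(i+2)\<close>, it is unique and its entries are linear forms.
\<close>

definition represents_conic ::
    "(3, 'k::field) mpol set \<Rightarrow> (3, 'k) mpol list \<Rightarrow> (3, 'k) mpol list \<Rightarrow> (6, 'k) mpol mat \<Rightarrow> bool"
  where
  "represents_conic J bs cs M \<longleftrightarrow>
     M \<in> carrier_mat (length cs) (length bs) \<and>
     (\<forall>j<length bs.
        residue_class (extended_ideal J) (generic_conic * lift_coeffs (bs ! j)) =
        residue_class (extended_ideal J)
          (\<Sum>l<length cs. Const (M $$ (l, j)) * lift_coeffs (cs ! l)))"

definition maximal_minors :: "'a::comm_ring_1 mat \<Rightarrow> 'a set" where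
  "maximal_minors M = {det (submatrix M rs cs) |rs cs.
     rs \<subseteq> {..<dim_row M} \<and> cs \<subseteq> {..<dim_col M} \<and>
     card rs = min (dim_row M) (dim_col M) \<and> card cs = min (dim_row M) (dim_col M)}"

text \<open>
  A change of bases multiplies \<open>M\<close> by invertible matrices over \<open>k\<close>, so each choice of bases gives
  the same ideal of maximal minors; letting the bases range over all choices avoids fixing one.
\<close>

definition conic_ideal_at :: "(3, 'k::field) mpol set \<Rightarrow> nat \<Rightarrow> (6, 'k) mpol set" where
  "conic_ideal_at J i = ideal_gen (\<Union> {maximal_minors M |M bs cs.
     basis_of_piece J i bs \<and> basis_of_piece J (i + 2) cs \<and> represents_conic J bs cs M})"

definition conic_ideal :: "(3, 'k::field) mpol set \<Rightarrow> (6, 'k) mpol set" where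
  "conic_ideal J = (\<Inter>i\<in>{i. i + 2 \<le> socle_degree J}. conic_ideal_at J i)"

definition non_lefschetz_conics :: "(3, 'k::field) mpol set \<Rightarrow> (6, 'k) mpol set set" where
  "non_lefschetz_conics J = vanishing_set (conic_ideal J)"

definition monomial_ci_ideal :: "nat \<Rightarrow> nat \<Rightarrow> nat \<Rightarrow> (3, 'k::field) mpol set" where
  "monomial_ci_ideal d1 d2 d3 = ideal_gen {Var 1 ^ d1, Var 2 ^ d2, Var 3 ^ d3}"

end

theory Submission
  imports Defs
begin

text \<open>
  The hyperplane \<open>a\<^sub>6 = 0\<close> of conics through \<open>(0 : 0 : 1)\<close> lies in the locus. Write \<open>s = d\<^sub>1 + d\<^sub>2 = d\<^sub>3\<close>.
  In degree \<open>s - 3\<close> the matrix of the generic conic has exactly one row more than columns, so its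
  maximal minors vanish modulo \<open>a\<^sub>6\<close> as soon as two independent functionals on \<open>[A]\<^bsub>s-1\<^esub>\<close> kill the
  image; when \<open>a\<^sub>6 = 0\<close> these exist on \<open>\<langle>x\<^sub>3\<^bsup>s-1\<^esup>, x\<^sub>1 x\<^sub>3\<^bsup>s-2\<^esup>, x\<^sub>2 x\<^sub>3\<^bsup>s-2\<^esup>\<rangle>\<close>. Conversely the
  conic \<open>x\<^sub>3\<^sup>2\<close> maps standard monomials to standard monomials and has maximal rank in every degree,
  so the locus is not all of \<open>P\<^sup>5\<close>.
\<close>

text \<open>The relation \<open>d3 = d1 + d2\<close> makes two thresholds meet. Multiplication by
  \<open>x3^2\<close> keeps standard monomials standard while the target degree is below
  \<open>d3\<close>, and reaches all of them once the target degree is at least \<open>s\<close>,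
  because \<open>x1\<close> and \<open>x2\<close> contribute at most \<open>s - 2\<close>. So every
  degree falls in one of the two ranges, and \<open>s - 3\<close> is the last source degree of the
  first. One functional killing the image is forced there by the dimensions alone; only a second one
  lowers the rank below the number of columns. The locus is cut out by an intersection of ideals, so
  this single degree already puts the intersection inside \<open>(a6)\<close>. Nonvanishing needs
  all degrees: the product of one nonzero minor per degree lies in the intersection and is nonzero
  because \<open>S\<close> is a domain. Minors range over all bases. The containment therefore reads
  coefficient functionals in the coordinates of an arbitrary basis, while nonvanishing is free to
  use monomials.\<close>

abbreviation coef :: "('v, 'a::zero) mpol \<Rightarrow> ('v \<Rightarrow>\<^sub>0 nat) \<Rightarrow> 'a" where
  "coef \<equiv> Poly_Mapping.lookup"

abbreviation supp :: "('v, 'a::zero) mpol \<Rightarrow> ('v \<Rightarrow>\<^sub>0 nat) set" where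
  "supp \<equiv> Poly_Mapping.keys"

abbreviation trm :: "('v \<Rightarrow>\<^sub>0 nat) \<Rightarrow> 'a \<Rightarrow> ('v, 'a::zero) mpol" where
  "trm \<equiv> Poly_Mapping.single"

abbreviation expo :: "'v \<Rightarrow> nat \<Rightarrow> 'v \<Rightarrow>\<^sub>0 nat" where
  "expo \<equiv> Poly_Mapping.single"

section \<open>Coefficients\<close>

lemma coef_trm_mult:
  fixes g :: "('v, 'a::comm_ring_1) mpol"
  shows "coef (trm k a * g) (k + m) = a * coef g m"
proof -
  have "coef (trm k a * g) (k + m) =
      (\<Sum>l. (a * (\<Sum>q. coef g q when k + m = l + q)) when l = k)"
    unfolding lookup_mult by (rule Sum_any.cong) (auto simp: lookup_single when_def)
  then show ?thesis by simp
qed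

lemma coef_trm_mult_eq_0:
  fixes g :: "('v, 'a::comm_ring_1) mpol"
  assumes "\<And>m'. m \<noteq> k + m'"
  shows "coef (trm k a * g) m = 0"
  using keys_mult[of "trm k a" g] assms by (force simp: in_keys_iff split: if_splits)

lemma coef_Const_mult:
  "coef (Const c * g) m = c * coef (g :: ('v, 'a::comm_ring_1) mpol) m"
  using coef_trm_mult[of 0 c g m] by (simp add: Const_def)

lemma Const_mult_trm: "Const c * trm m a = (trm m (c * a) :: ('v, 'a::comm_ring_1) mpol)"
  by (simp add: Const_def mult_single)

lemma coef_sum_trms:
  assumes "distinct ms" and "l < length ms"
  shows "coef (\<Sum>j<length ms. Const (c j) * trm (ms ! j) (1::'a::comm_ring_1)) (ms ! l) = c l"
proof -
  have "coef (\<Sum>j<length ms. Const (c j) * trm (ms ! j) (1::'a)) (ms ! l) =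
      (\<Sum>j<length ms. if j = l then c j else 0)"
    unfolding lookup_sum using assms
    by (intro sum.cong) (auto simp: Const_mult_trm lookup_single nth_eq_iff_index_eq when_def)
  then show ?thesis using assms by simp
qed

lemma coef_sum_trms_eq_0:
  assumes "m \<notin> set ms"
  shows "coef (\<Sum>j<length ms. Const (c j) * trm (ms ! j) (1::'a::comm_ring_1)) m = 0"
  unfolding lookup_sum using assms
  by (intro sum.neutral ballI) (auto simp: Const_mult_trm lookup_single when_def)

lemma mpol_sum_trms: "f = (\<Sum>m\<in>supp f. trm m (coef f m))"
  by (rule poly_mapping_eqI) (simp add: lookup_sum lookup_single when_def in_keys_iff)

lemma Var_power: "Var v ^ n = (trm (expo v n) 1 :: ('v, 'a::comm_ring_1) mpol)"
  by (induction n) (simp_all add: Var_def mult_single flip: Poly_Mapping.single_add)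

lemma mdeg_add: "mdeg (m + m') = mdeg m + mdeg m'"
  by (simp add: mdeg_def lookup_add sum.distrib)

lemma mdeg_expo [simp]: "mdeg (expo v n) = n"
  by (simp add: mdeg_def lookup_single when_def)


section \<open>Ideals\<close>

lemma ideal_typ_ringI:
  fixes I :: "'a::comm_ring_1 set"
  assumes "0 \<in> I" "\<And>a b. a \<in> I \<Longrightarrow> b \<in> I \<Longrightarrow> a + b \<in> I" "\<And>a x. a \<in> I \<Longrightarrow> x * a \<in> I"
  shows "ideal I typ_ring"
proof (rule idealI)
  show "ring (typ_ring :: 'a ring)" by (rule ring_from_type_algebra)
  interpret ring "typ_ring :: 'a ring" by (rule ring_from_type_algebra)
  show "subgroup I (add_monoid (typ_ring :: 'a ring))"
  proof
    fix x assume "x \<in> I"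
    have "\<ominus>\<^bsub>typ_ring\<^esub> x = - x"
      by (rule minus_equality) (auto simp: ring_of_type_algebra_def)
    then show "inv\<^bsub>add_monoid (typ_ring :: 'a ring)\<^esub> x \<in> I"
      using assms(3)[OF \<open>x \<in> I\<close>, of "-1"] by (simp add: a_inv_def)
  qed (use assms in \<open>auto simp: ring_of_type_algebra_def\<close>)
qed (use assms in \<open>auto simp: ring_of_type_algebra_def mult.commute\<close>)

lemma ideal_typ_ringD:
  fixes I :: "'a::comm_ring_1 set"
  assumes "ideal I typ_ring"
  shows "0 \<in> I" "a \<in> I \<Longrightarrow> b \<in> I \<Longrightarrow> a + b \<in> I" "a \<in> I \<Longrightarrow> x * a \<in> I"
proof -
  interpret ideal I typ_ring by fact
  show "0 \<in> I" using zero_closed additive_subgroup.zero_closed[OF is_additive_subgroup]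
    by (simp add: ring_of_type_algebra_def)
  show "a \<in> I \<Longrightarrow> b \<in> I \<Longrightarrow> a + b \<in> I"
    using additive_subgroup.a_closed[OF is_additive_subgroup] by (simp add: ring_of_type_algebra_def)
  show "a \<in> I \<Longrightarrow> x * a \<in> I" using I_l_closed by (simp add: ring_of_type_algebra_def)
qed

lemma ideal_sum_closed:
  fixes I :: "'a::comm_ring_1 set"
  assumes "ideal I typ_ring" "\<And>x. x \<in> A \<Longrightarrow> f x \<in> I"
  shows "(\<Sum>x\<in>A. f x) \<in> I"
  using assms(2) by (induction A rule: infinite_finite_induct) (auto intro: ideal_typ_ringD[OF assms(1)])

lemma ideal_ideal_gen: "ideal (ideal_gen G) (typ_ring :: 'a::comm_ring_1 ring)"
  unfolding ideal_gen_def
  by (rule ring.genideal_ideal[OF ring_from_type_algebra]) (simp add: ring_of_type_algebra_def)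

lemma ideal_gen_superset: "G \<subseteq> ideal_gen (G :: 'a::comm_ring_1 set)"
  unfolding ideal_gen_def
  by (rule ring.genideal_self[OF ring_from_type_algebra]) (simp add: ring_of_type_algebra_def)

lemma ideal_gen_minimal: "ideal I typ_ring \<Longrightarrow> G \<subseteq> I \<Longrightarrow> ideal_gen G \<subseteq> (I :: 'a::comm_ring_1 set)"
  unfolding ideal_gen_def by (rule ring.genideal_minimal[OF ring_from_type_algebra])

lemma residue_class_eq_iff:
  fixes I :: "'a::comm_ring_1 set"
  assumes "ideal I typ_ring"
  shows "residue_class I f = residue_class I g \<longleftrightarrow> f - g \<in> I"
proof -
  interpret ring "typ_ring :: 'a ring" by (rule ring_from_type_algebra)
  have inv: "\<ominus>\<^bsub>typ_ring\<^esub> x = - x" for x :: 'a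
    by (rule minus_equality) (auto simp: ring_of_type_algebra_def)
  have "f \<ominus>\<^bsub>typ_ring\<^esub> g = f - g"
    unfolding a_minus_def inv by (simp add: ring_of_type_algebra_def)
  then show ?thesis
    using quotient_eq_iff_same_a_r_cos[OF assms, of f g]
    by (simp add: residue_class_def ring_of_type_algebra_def)
qed


section \<open>Monomial ideals and quotients by coordinate subspaces\<close>

text \<open>These are the exponent sets of monomial ideals. One notion serves \<open>J\<close>, its
  extension to \<open>S\<close>, and the ideal of a coordinate hyperplane.\<close>

definition up_closed :: "('v \<Rightarrow>\<^sub>0 nat) set \<Rightarrow> bool" where
  "up_closed U \<longleftrightarrow> (\<forall>m\<in>U. \<forall>m'. m' + m \<in> U)"

lemma ideal_supp_subset:
  assumes "up_closed U"
  shows "ideal {f :: ('v, 'a::comm_ring_1) mpol. supp f \<subseteq> U} typ_ring"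
proof (rule ideal_typ_ringI)
  fix f g :: "('v, 'a) mpol"
  assume f: "f \<in> {f. supp f \<subseteq> U}"
  show "g * f \<in> {f. supp f \<subseteq> U}"
    using f assms keys_mult[of g f] unfolding up_closed_def by fastforce
  assume "g \<in> {f. supp f \<subseteq> U}"
  then show "f + g \<in> {f. supp f \<subseteq> U}" using f keys_add[of f g] by auto
qed simp

lemma mem_supp_subset_iff: "f \<in> {f. supp f \<subseteq> U} \<longleftrightarrow> (\<forall>m. m \<notin> U \<longrightarrow> coef f m = 0)"
  by (auto simp: subset_iff in_keys_iff)

definition restrict_supp :: "('v \<Rightarrow>\<^sub>0 nat) set \<Rightarrow> ('v, 'a::comm_ring_1) mpol \<Rightarrow> ('v, 'a) mpol" where
  "restrict_supp F = Poly_Mapping.mapp (\<lambda>m c. c when m \<in> F)"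

lemma coef_restrict_supp: "coef (restrict_supp F f) m = (coef f m when m \<in> F)"
  by (auto simp: restrict_supp_def lookup_mapp when_def in_keys_iff)

lemma restrict_supp_trm: "restrict_supp F (trm m c) = (if m \<in> F then trm m c else 0)"
  by (rule poly_mapping_eqI) (auto simp: coef_restrict_supp lookup_single when_def)

lemma restrict_supp_eq_0_iff: "restrict_supp F f = 0 \<longleftrightarrow> supp f \<subseteq> - F"
  by (auto simp: poly_mapping_eq_iff fun_eq_iff coef_restrict_supp when_def in_keys_iff subset_iff)

text \<open>For a face \<open>F\<close>, \<open>restrict_supp F\<close> substitutes 0 for the variables outside \<open>F\<close>.\<close>

definition face :: "('v \<Rightarrow>\<^sub>0 nat) set \<Rightarrow> bool" where
  "face F \<longleftrightarrow> 0 \<in> F \<and> (\<forall>m m'. m + m' \<in> F \<longleftrightarrow> m \<in> F \<and> m' \<in> F)"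

text \<open>An exponent sum lies in a face exactly when both summands do, so a product of terms
  survives the restriction iff both factors survive. The homomorphism property is what carries the
  restriction through determinants.\<close>

lemma restrict_supp_hom:
  assumes "face F"
  shows "comm_ring_hom (restrict_supp F :: ('v, 'a::comm_ring_1) mpol \<Rightarrow> _)"
proof
  fix f g :: "('v, 'a) mpol"
  show "restrict_supp F (f + g) = restrict_supp F f + restrict_supp F g"
    by (rule poly_mapping_eqI) (simp add: coef_restrict_supp lookup_add when_def)
  show "restrict_supp F (f * g) = restrict_supp F f * restrict_supp F g"
  proof (rule poly_mapping_eqI)
    fix k
    have "coef (restrict_supp F (f * g)) k = (\<Sum>l. coef f l * (\<Sum>q. coef g q when k = l + q) when k \<in> F)"
      by (simp add: coef_restrict_supp lookup_mult Sum_any_when_independent)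
    also have "\<dots> = (\<Sum>l. coef (restrict_supp F f) l * (\<Sum>q. coef (restrict_supp F g) q when k = l + q))"
    proof (rule Sum_any.cong)
      fix l
      have "(\<Sum>q. coef (restrict_supp F g) q when k = l + q) = (\<Sum>q. coef g q when k = l + q) \<or> l \<notin> F \<or> k \<notin> F"
        using assms by (auto simp: coef_restrict_supp when_def face_def intro!: Sum_any.cong split: if_splits)
      moreover have "(\<Sum>q. coef (restrict_supp F g) q when k = l + q) = 0" if "k \<notin> F" "l \<in> F"
      proof -
        have "(coef (restrict_supp F g) q when k = l + q) = 0" for q
          using assms that by (auto simp: coef_restrict_supp when_def face_def)
        then show ?thesis by simp
      qed
      moreover have "(\<Sum>q. coef g q when k = l + q) = 0" if "k \<in> F" "l \<notin> F"
      proof -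
        have "(coef g q when k = l + q) = 0" for q
          using assms that by (auto simp: when_def face_def)
        then show ?thesis by simp
      qed
      ultimately show "(coef f l * (\<Sum>q. coef g q when k = l + q) when k \<in> F) =
          coef (restrict_supp F f) l * (\<Sum>q. coef (restrict_supp F g) q when k = l + q)"
        by (auto simp: coef_restrict_supp when_def)
    qed
    finally show "coef (restrict_supp F (f * g)) k = coef (restrict_supp F f * restrict_supp F g) k"
      by (simp add: lookup_mult)
  qed
  show "restrict_supp F 0 = (0 :: ('v, 'a) mpol)"
    by (rule poly_mapping_eqI) (simp add: coef_restrict_supp)
  show "restrict_supp F 1 = (1 :: ('v, 'a) mpol)"
    using assms by (auto intro!: poly_mapping_eqI simp: coef_restrict_supp lookup_one when_def face_def)
qed

section \<open>The codimension of a hypersurface containing a coordinate hyperplane\<close>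

text \<open>This is the principal ideal \<open>(Var v)\<close>; see \<open>hyperplane_dvd\<close>.
  The support form exhibits it both as a monomial ideal and as the kernel of the substitution of 0
  for \<open>Var v\<close>.\<close>

definition hyperplane :: "'v \<Rightarrow> ('v, 'a::comm_ring_1) mpol set" where
  "hyperplane v = {f. supp f \<subseteq> {m. Poly_Mapping.lookup m v \<noteq> 0}}"

lemma up_closed_hyperplane: "up_closed {m. Poly_Mapping.lookup m v \<noteq> 0}"
  by (simp add: up_closed_def lookup_add)

lemma face_hyperplane: "face {m. Poly_Mapping.lookup m v = 0}"
  by (simp add: face_def lookup_add)

lemma mem_hyperplane_iff:
  "f \<in> hyperplane v \<longleftrightarrow> restrict_supp {m. Poly_Mapping.lookup m v = 0} f = 0"
  by (auto simp: hyperplane_def restrict_supp_eq_0_iff)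

lemma ideal_hyperplane: "ideal (hyperplane v :: ('v, 'a::comm_ring_1) mpol set) typ_ring"
  unfolding hyperplane_def by (rule ideal_supp_subset[OF up_closed_hyperplane])

lemma Var_mem_hyperplane_iff: "Var w \<in> (hyperplane v :: ('v, 'a::comm_ring_1) mpol set) \<longleftrightarrow> w = v"
  by (auto simp: Var_def hyperplane_def lookup_single when_def)

lemma hyperplane_dvd:
  assumes "f \<in> (hyperplane v :: ('v, 'a::comm_ring_1) mpol set)"
  shows "Var v dvd f"
proof -
  have "Var v dvd trm m (coef f m)" if "m \<in> supp f" for m
  proof
    have "m = expo v 1 + (m - expo v 1)"
      using that assms
      by (intro poly_mapping_eqI) (auto simp: hyperplane_def lookup_add lookup_minus lookup_single when_def)
    then show "trm m (coef f m) = Var v * trm (m - expo v 1) (coef f m)"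
      by (simp add: Var_def mult_single)
  qed
  then show ?thesis by (subst mpol_sum_trms) (rule dvd_sum)
qed

section \<open>Generic points and irreducible closed subsets of Proj\<close>

lemma primeideal_typ_ringI:
  fixes P :: "'a::comm_ring_1 set"
  assumes "ideal P typ_ring" "1 \<notin> P" "\<And>f g. f * g \<in> P \<Longrightarrow> f \<in> P \<or> g \<in> P"
  shows "primeideal P typ_ring"
  by (rule primeidealI)
    (use assms in \<open>auto simp: ring_of_type_algebra_def cring_from_type_algebra[unfolded ring_of_type_algebra_def]\<close>)

lemma supp_hom_part: "supp (hom_part n f) \<subseteq> supp f"
  by (auto simp: hom_part_def in_keys_iff lookup_sum lookup_single when_def intro!: sum.neutral)

text \<open>Prime as the kernel of a homomorphism into a domain; the second variable
  \<open>w\<close> keeps the irrelevant ideal out. The linear order on \<open>'v\<close> makes the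
  polynomial ring an instance of \<open>idom\<close>.\<close>

lemma hyperplane_proj_point:
  fixes v w :: "'v::{finite, linorder}"
  assumes "w \<noteq> v"
  shows "(hyperplane v :: ('v, 'a::idom) mpol set) \<in> proj_points"
proof -
  interpret comm_ring_hom
    "restrict_supp {m. Poly_Mapping.lookup m v = 0} :: ('v, 'a) mpol \<Rightarrow> ('v, 'a) mpol"
    by (rule restrict_supp_hom[OF face_hyperplane])
  have "primeideal (hyperplane v :: ('v, 'a) mpol set) typ_ring"
    by (rule primeideal_typ_ringI[OF ideal_hyperplane]) (auto simp: mem_hyperplane_iff hom_mult)
  moreover have "homogeneous_ideal (hyperplane v :: ('v, 'a) mpol set)"
    using ideal_hyperplane supp_hom_part by (force simp: homogeneous_ideal_def hyperplane_def)
  ultimately show ?thesis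
    using assms Var_mem_hyperplane_iff[of w v] by (auto simp: proj_points_def)
qed

text \<open>This is the generic point of projective space: a closed set containing it is
  everything.\<close>

lemma zero_ideal_proj_point: "{0} \<in> (proj_points :: ('v::{finite, linorder}, 'a::idom) mpol set set)"
proof -
  have id: "ideal {0 :: ('v, 'a) mpol} typ_ring" by (rule ideal_typ_ringI) auto
  then have "primeideal {0 :: ('v, 'a) mpol} typ_ring" by (rule primeideal_typ_ringI) auto
  moreover have "homogeneous_ideal {0 :: ('v, 'a) mpol}"
    using id by (simp add: homogeneous_ideal_def hom_part_def)
  moreover have "Var v \<noteq> (0 :: ('v, 'a) mpol)" for v
    by (simp add: Var_def flip: keys_eq_empty)
  ultimately show ?thesis by (auto simp: proj_points_def)
qed

text \<open>\<open>P\<close> is a generic point of its vanishing set: a closed set containing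
  \<open>P\<close> contains every prime above \<open>P\<close>, so whichever of two covering sets
  contains \<open>P\<close> contains them all.\<close>

lemma irreducible_closed_vanishing_set:
  assumes "P \<in> proj_points"
  shows "irreducible_closed proj_topology (vanishing_set P)"
  using assms by (auto simp: irreducible_closed_def closedin_proj vanishing_set_def)

definition vanishing_ideal :: "('v, 'a::comm_ring_1) mpol set set \<Rightarrow> ('v, 'a) mpol set" where
  "vanishing_ideal Z = \<Inter> Z"

text \<open>Every prime in \<open>Z\<close> contains \<open>f\<close> or \<open>g\<close>, so the
  zero sets of \<open>f\<close> and \<open>g\<close> cover \<open>Z\<close>. Neither factor has to
  be homogeneous, since vanishing sets accept arbitrary polynomials.\<close>

lemma irreducible_vanishing_ideal_prime:
  assumes "irreducible_closed proj_topology Z" "f * g \<in> vanishing_ideal Z"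
  shows "f \<in> vanishing_ideal Z \<or> g \<in> vanishing_ideal Z"
proof -
  have Z: "Z \<subseteq> proj_points" using assms(1) by (auto simp: irreducible_closed_def closedin_proj vanishing_set_def)
  have "f \<in> P \<or> g \<in> P" if "P \<in> Z" for P
  proof -
    interpret primeideal P typ_ring using that Z by (auto simp: proj_points_def)
    show ?thesis using that assms(2) I_prime[of f g]
      by (auto simp: vanishing_ideal_def ring_of_type_algebra_def)
  qed
  then have "Z \<subseteq> vanishing_set {f} \<union> vanishing_set {g}"
    using Z by (auto simp: vanishing_set_def)
  then have "Z \<subseteq> vanishing_set {f} \<or> Z \<subseteq> vanishing_set {g}"
    using assms(1) by (auto simp: irreducible_closed_def closedin_proj)
  then show ?thesis by (auto simp: vanishing_set_def vanishing_ideal_def)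
qed

text \<open>
  A prime strictly inside the principal prime \<open>(x\<^sub>v)\<close> is stable under division by \<open>x\<^sub>v\<close>, so its
  elements are divisible by all powers of \<open>x\<^sub>v\<close>.
\<close>

lemma irreducible_closed_above_hyperplane:
  fixes Z :: "('v::{finite, linorder}, 'a::idom) mpol set set"
  assumes Z: "irreducible_closed proj_topology Z" and "vanishing_set (hyperplane v) \<subset> Z"
    and "w \<noteq> v"
  shows "Z = proj_points"
proof -
  have Zp: "Z \<subseteq> proj_points" using Z by (auto simp: irreducible_closed_def closedin_proj vanishing_set_def)
  have "hyperplane v \<in> Z"
    using assms(2) hyperplane_proj_point[OF assms(3)] by (auto simp: vanishing_set_def)
  then have sub: "vanishing_ideal Z \<subseteq> hyperplane v" by (auto simp: vanishing_ideal_def)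
  \<comment> \<open>Otherwise every prime in \<open>Z\<close> would contain the principal ideal
    \<open>hyperplane v\<close>, and \<open>Z\<close> would not be strictly larger than its
    vanishing set.\<close>
  have notin: "Var v \<notin> vanishing_ideal Z"
  proof
    assume *: "Var v \<in> vanishing_ideal Z"
    have "hyperplane v \<subseteq> P" if "P \<in> Z" for P
    proof
      fix f :: "('v, 'a) mpol" assume "f \<in> hyperplane v"
      then obtain g where "f = g * Var v" using hyperplane_dvd by (metis dvdE mult.commute)
      moreover have "ideal P typ_ring"
        using that Zp by (auto simp: proj_points_def homogeneous_ideal_def)
      ultimately show "f \<in> P" using * that ideal_typ_ringD(3) by (auto simp: vanishing_ideal_def)
    qed
    then show False using assms(2) Zp by (auto simp: vanishing_set_def)
  qed
  have "\<forall>f\<in>vanishing_ideal Z. \<forall>m\<in>supp f. n \<le> Poly_Mapping.lookup m v" for n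
  proof (induction n)
    case (Suc n)
    show ?case
    proof (intro ballI)
      fix f m assume f: "f \<in> vanishing_ideal Z" "m \<in> supp f"
      then obtain g where g: "f = Var v * g" using sub hyperplane_dvd by (metis dvdE subsetD)
      then have "g \<in> vanishing_ideal Z"
        using f irreducible_vanishing_ideal_prime[OF Z, of "Var v" g] notin by simp
      moreover obtain m' where "m' \<in> supp g" "m = expo v 1 + m'"
        using keys_mult[of "Var v" g] f(2) unfolding g by (auto simp: Var_def)
      ultimately show "Suc n \<le> Poly_Mapping.lookup m v" using Suc by (simp add: lookup_add)
    qed
  qed simp
  then have "supp f = {}" if "f \<in> vanishing_ideal Z" for f
    using that by (metis Suc_n_not_le_n equals0I)
  then have zero: "vanishing_ideal Z \<subseteq> {0}" by auto
  obtain T where T: "Z = vanishing_set T" using Z by (auto simp: irreducible_closed_def closedin_proj)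
  then have "T \<subseteq> {0}" using zero by (auto simp: vanishing_ideal_def vanishing_set_def)
  moreover have "0 \<in> P" if "P \<in> proj_points" for P :: "('v, 'a) mpol set"
    using that ideal_typ_ringD(1) by (auto simp: proj_points_def homogeneous_ideal_def)
  ultimately show ?thesis using T by (auto simp: vanishing_set_def)
qed

lemma irreducible_closed_proj_points:
  "irreducible_closed proj_topology (proj_points :: ('v::{finite, linorder}, 'a::idom) mpol set set)"
proof -
  have "0 \<in> P" if "P \<in> proj_points" for P :: "('v, 'a) mpol set"
    using that ideal_typ_ringD(1) by (auto simp: proj_points_def homogeneous_ideal_def)
  then have eq: "vanishing_set {0} = (proj_points :: ('v, 'a) mpol set set)"
    by (auto simp: vanishing_set_def)
  show ?thesis
    using irreducible_closed_vanishing_set[OF zero_ideal_proj_point[where 'v='v and 'a='a]]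
    unfolding eq .
qed

text \<open>At most 1: the coordinate hyperplane lies in the vanishing set, and above it a chain can
  only continue with the whole space. At least 1: the nonzero \<open>f\<close> keeps the generic
  point out, so each irreducible closed subset of the vanishing set is proper and starts a chain
  ending with the whole space.\<close>

lemma codimension_eq_1:
  fixes I :: "('v::{finite, linorder}, 'a::idom) mpol set"
  assumes "I \<subseteq> hyperplane v" "w \<noteq> v" "f \<in> I" "f \<noteq> 0"
  shows "codimension proj_topology (vanishing_set I) = 1"
proof (rule antisym)
  let ?\<X> = "proj_topology :: ('v, 'a) mpol set topology" and ?H = "hyperplane v :: ('v, 'a) mpol set"
  have "codim_irreducible ?\<X> (vanishing_set ?H) \<le> 1"
    unfolding codim_irreducible_def
  proof (rule Sup_least, clarify)
    fix n Zs
    assume Zs: "Zs 0 = vanishing_set ?H" "\<forall>i\<le>n. irreducible_closed ?\<X> (Zs i)" "\<forall>i<n. Zs i \<subset> Zs (Suc i)"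
    have "\<not> 2 \<le> n"
    proof
      assume "2 \<le> n"
      note that = this
      have "Zs 0 \<subset> Zs 1" using Zs(3) that by (auto dest: spec[of _ 0])
      then have "Zs 1 = proj_points"
        using Zs(1,2) that by (intro irreducible_closed_above_hyperplane[OF _ _ assms(2)]) auto
      moreover have "Zs 1 \<subset> Zs 2" using Zs(3) that by (auto dest: spec[of _ 1] simp: numeral_2_eq_2)
      moreover have "Zs 2 \<subseteq> proj_points"
        using Zs(2) that by (auto simp: irreducible_closed_def closedin_proj vanishing_set_def)
      ultimately show False by simp
    qed
    then have "n \<le> 1" by linarith
    then show "enat n \<le> 1" by (simp add: one_enat_def)
  qed
  moreover have "vanishing_set ?H \<subseteq> vanishing_set I" using assms(1) by (auto simp: vanishing_set_def)
  ultimately show "codimension ?\<X> (vanishing_set I) \<le> 1"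
    unfolding codimension_def
    using irreducible_closed_vanishing_set[OF hyperplane_proj_point[OF assms(2)]]
    by (intro Inf_lower2[of "codim_irreducible ?\<X> (vanishing_set ?H)"]) blast+
  show "1 \<le> codimension ?\<X> (vanishing_set I)"
    unfolding codimension_def
  proof (rule Inf_greatest, clarify)
    fix Z assume Z: "Z \<subseteq> vanishing_set I" "irreducible_closed ?\<X> Z"
    have "{0} \<notin> vanishing_set I" using assms by (auto simp: vanishing_set_def)
    then have "Z \<subset> proj_points" using Z zero_ideal_proj_point[where 'v='v and 'a='a] by (auto simp: vanishing_set_def)
    then have "\<exists>Zs. Zs 0 = Z \<and> (\<forall>i\<le>1. irreducible_closed ?\<X> (Zs i)) \<and> (\<forall>i<1. Zs i \<subset> Zs (Suc i))"
      using Z irreducible_closed_proj_points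
      by (intro exI[of _ "\<lambda>i::nat. if i = 0 then Z else proj_points"]) auto
    then show "1 \<le> codim_irreducible ?\<X> Z"
      unfolding codim_irreducible_def one_enat_def by (intro Sup_upper) blast
  qed
qed

section \<open>The monomial complete intersection\<close>

lemma exhaust_3: "v = 1 \<or> v = 2 \<or> v = (3 :: 3)"
proof (induction v)
  case (of_int z)
  \<comment> \<open>In the type \<open>3\<close> the numeral 3 is 0, so \<open>z = 0\<close> yields
    the third disjunct.\<close>
  then have "z = 0 \<or> z = 1 \<or> z = 2" by auto
  then show ?case by auto
qed

lemma UNIV_3: "(UNIV :: 3 set) = {1, 2, 3}"
  using exhaust_3 by auto

lemma mdeg_3: "mdeg (m :: 3 \<Rightarrow>\<^sub>0 nat) =
    Poly_Mapping.lookup m 1 + Poly_Mapping.lookup m 2 + Poly_Mapping.lookup m 3"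
  unfolding mdeg_def UNIV_3 by simp

lemma exponents_3_eqI:
  assumes "Poly_Mapping.lookup m 1 = Poly_Mapping.lookup m' 1"
    "Poly_Mapping.lookup m 2 = Poly_Mapping.lookup m' 2"
    "Poly_Mapping.lookup m 3 = Poly_Mapping.lookup m' (3::3)"
  shows "m = m'"
proof (rule poly_mapping_eqI)
  fix v :: 3
  from exhaust_3[of v] assms show "Poly_Mapping.lookup m v = Poly_Mapping.lookup m' v" by (elim disjE) simp_all
qed

definition ci_exponents :: "nat \<Rightarrow> nat \<Rightarrow> nat \<Rightarrow> (3 \<Rightarrow>\<^sub>0 nat) set" where
  "ci_exponents d1 d2 d3 = {m. d1 \<le> Poly_Mapping.lookup m 1 \<or>
     d2 \<le> Poly_Mapping.lookup m 2 \<or> d3 \<le> Poly_Mapping.lookup m 3}"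

lemma up_closed_ci_exponents: "up_closed (ci_exponents d1 d2 d3)"
  by (auto simp: up_closed_def ci_exponents_def lookup_add)

text \<open>Each term with a large exponent is a multiple of a generator, so membership can be read
  off the support. The coefficient ring is left general because both \<open>k\<close> and
  \<open>S\<close> occur.\<close>

lemma ideal_gen_Var_powers:
  "ideal_gen {Var 1 ^ d1, Var 2 ^ d2, Var 3 ^ d3} =
     {f :: (3, 'a::comm_ring_1) mpol. supp f \<subseteq> ci_exponents d1 d2 d3}" (is "ideal_gen ?G = ?I")
proof
  show "ideal_gen ?G \<subseteq> ?I"
    by (rule ideal_gen_minimal[OF ideal_supp_subset[OF up_closed_ci_exponents]])
      (auto simp: Var_power ci_exponents_def lookup_single when_def)
  show "?I \<subseteq> ideal_gen ?G"
  proof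
    fix f assume f: "f \<in> ?I"
    have *: "trm m (coef f m) \<in> ideal_gen ?G" if "Var v ^ d \<in> ?G" "d \<le> Poly_Mapping.lookup m v" for v d m
    proof -
      have eq: "(m - expo v d) + expo v d = m"
        using that(2) by (intro poly_mapping_eqI) (auto simp: lookup_add lookup_minus lookup_single when_def)
      have "trm m (coef f m) = trm (m - expo v d) (coef f m) * Var v ^ d"
        unfolding Var_power mult_single eq by simp
      moreover have "Var v ^ d \<in> ideal_gen ?G" by (rule subsetD[OF ideal_gen_superset that(1)])
      ultimately show ?thesis using ideal_typ_ringD(3)[OF ideal_ideal_gen] by simp
    qed
    have "trm m (coef f m) \<in> ideal_gen ?G" if "m \<in> supp f" for m
    proof -
      have "m \<in> ci_exponents d1 d2 d3" using f that by auto
      then show ?thesis using *[of 1 d1] *[of 2 d2] *[of 3 d3] by (auto simp: ci_exponents_def)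
    qed
    then have "(\<Sum>m\<in>supp f. trm m (coef f m)) \<in> ideal_gen ?G"
      by (rule ideal_sum_closed[OF ideal_ideal_gen])
    then show "f \<in> ideal_gen ?G" unfolding mpol_sum_trms[of f, symmetric] .
  qed
qed

section \<open>Extension of scalars from \<open>k\<close> to \<open>S\<close>\<close>

lemma coef_lift_coeffs: "coef (lift_coeffs f) m = Const (coef f m)"
  by (simp add: lift_coeffs_def Const_def Poly_Mapping.map.rep_eq when_def)

lemma lift_coeffs_trm: "lift_coeffs (trm m c) = trm m (Const c)"
  by (rule poly_mapping_eqI) (simp add: coef_lift_coeffs lookup_single when_def Const_def)

lemma Const_eq_0_iff: "Const c = (0 :: ('v, 'a::comm_ring_1) mpol) \<longleftrightarrow> c = 0"
  by (simp add: Const_def flip: keys_eq_empty)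

text \<open>Lifting coefficients fixes the three generators, so the extended ideal is given by the
  same exponents and the standard monomials of \<open>A\<close> also serve for the extension to
  \<open>S\<close>.\<close>

lemma extended_ideal_ci:
  "extended_ideal (monomial_ci_ideal d1 d2 d3 :: (3, 'k::field) mpol set) =
     {f. supp f \<subseteq> ci_exponents d1 d2 d3}" (is "_ = ?I")
proof
  show "extended_ideal (monomial_ci_ideal d1 d2 d3 :: (3, 'k) mpol set) \<subseteq> ?I"
    unfolding extended_ideal_def
  proof (rule ideal_gen_minimal[OF ideal_supp_subset[OF up_closed_ci_exponents]], clarify)
    fix f :: "(3, 'k) mpol" and m
    assume "f \<in> monomial_ci_ideal d1 d2 d3" "m \<in> supp (lift_coeffs f)"
    then show "m \<in> ci_exponents d1 d2 d3"
      unfolding monomial_ci_ideal_def ideal_gen_Var_powers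
      by (simp add: subset_iff in_keys_iff coef_lift_coeffs Const_eq_0_iff)
  qed
  have "lift_coeffs (Var v ^ d :: (3, 'k) mpol) = Var v ^ d" for v d
    by (simp add: Var_power lift_coeffs_trm) (simp add: Const_def)
  then have "lift_coeffs ` {Var 1 ^ d1, Var 2 ^ d2, Var 3 ^ d3 :: (3, 'k) mpol} = {Var 1 ^ d1, Var 2 ^ d2, Var 3 ^ d3}"
    by (simp only: image_insert image_empty)
  moreover have "lift_coeffs ` {Var 1 ^ d1, Var 2 ^ d2, Var 3 ^ d3 :: (3, 'k) mpol} \<subseteq>
      lift_coeffs ` monomial_ci_ideal d1 d2 d3"
    unfolding monomial_ci_ideal_def by (rule image_mono[OF ideal_gen_superset])
  ultimately have "{Var 1 ^ d1, Var 2 ^ d2, Var 3 ^ d3} \<subseteq> lift_coeffs ` (monomial_ci_ideal d1 d2 d3 :: (3, 'k) mpol set)"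
    by (simp only:)
  then have "{Var 1 ^ d1, Var 2 ^ d2, Var 3 ^ d3} \<subseteq> extended_ideal (monomial_ci_ideal d1 d2 d3 :: (3, 'k) mpol set)"
    unfolding extended_ideal_def by (rule order_trans[OF _ ideal_gen_superset])
  then show "?I \<subseteq> extended_ideal (monomial_ci_ideal d1 d2 d3 :: (3, 'k) mpol set)"
    unfolding ideal_gen_Var_powers[symmetric] extended_ideal_def
    by (rule ideal_gen_minimal[OF ideal_ideal_gen])
qed


section \<open>Bases of graded pieces\<close>

lemma ring_quot_alg: "ideal J typ_ring \<Longrightarrow> ring (quot_alg J)"
  unfolding quot_alg_def by (rule ideal.quotient_is_ring)

lemma residue_class_ring_hom: "ideal J typ_ring \<Longrightarrow> residue_class J \<in> Ring.ring_hom typ_ring (quot_alg J)"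
  unfolding quot_alg_def residue_class_def[abs_def] by (rule ideal.rcos_ring_hom)

lemma residue_class_simps:
  assumes "ideal J typ_ring"
  shows "residue_class J f \<oplus>\<^bsub>quot_alg J\<^esub> residue_class J g = residue_class J (f + g)"
    "residue_class J f \<otimes>\<^bsub>quot_alg J\<^esub> residue_class J g = residue_class J (f * g)"
    "\<one>\<^bsub>quot_alg J\<^esub> = residue_class J 1" "\<zero>\<^bsub>quot_alg J\<^esub> = residue_class J 0"
    "residue_class J f \<in> carrier (quot_alg J)"
  using ring_hom_add[OF residue_class_ring_hom[OF assms], of f g]
    ring_hom_mult[OF residue_class_ring_hom[OF assms], of f g]
    ring_hom_one[OF residue_class_ring_hom[OF assms]]
    ring_hom_closed[OF residue_class_ring_hom[OF assms], of f]
    ring_hom_zero[OF residue_class_ring_hom[OF assms] ring_from_type_algebra ring_quot_alg[OF assms]]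
  by (simp_all add: ring_of_type_algebra_def)

text \<open>A field maps isomorphically onto its image in a nonzero ring. This is the hypothesis
  under which the dimension theory of \<open>Embedded_Algebras\<close> applies to
  \<open>quot_alg J\<close>.\<close>

lemma scalars_subfield:
  assumes J: "ideal J typ_ring" and "1 \<notin> J"
  shows "subfield (scalars J) (quot_alg J)"
proof -
  let ?h = "\<lambda>c. residue_class J (Const c)"
  interpret K: Ring.field "typ_ring :: 'a ring" by (rule field_from_type_algebra)
  interpret Q: ring "quot_alg J" by (rule ring_quot_alg[OF J])
  have "?h \<in> Ring.ring_hom typ_ring (quot_alg J)"
    by (rule ring_hom_memI)
      (simp_all add: residue_class_simps[OF J] ring_of_type_algebra_def Const_def single_add mult_single)
  then interpret ring_hom_ring "typ_ring :: 'a ring" "quot_alg J" ?h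
    by (rule ring_hom_ringI2[OF K.ring_axioms Q.ring_axioms])
  have "\<one>\<^bsub>quot_alg J\<^esub> \<noteq> \<zero>\<^bsub>quot_alg J\<^esub>"
    using assms by (simp add: residue_class_simps residue_class_eq_iff)
  from img_is_subfield(2)[OF K.carrier_is_subfield this] show ?thesis
    by (simp add: scalars_def ring_of_type_algebra_def)
qed

lemma Span_residue_class:
  assumes J: "ideal J typ_ring"
  shows "ring.Span (quot_alg J) (scalars J) (map (residue_class J) bs) =
    residue_class J ` {\<Sum>l<length bs. Const (c l) * bs ! l |c. True}"
proof (induction bs)
  interpret Q: ring "quot_alg J" by (rule ring_quot_alg[OF J])
  {
    case Nil
    show ?case by (simp add: residue_class_simps[OF J])
  next
    case (Cons b bs)
    have sum: "(\<Sum>l<length (b # bs). Const (c l) * (b # bs) ! l) =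
        Const (c 0) * b + (\<Sum>l<length bs. Const (c (Suc l)) * bs ! l)" for c
      by (simp only: length_Cons sum.lessThan_Suc_shift) simp
    have Span: "Q.Span (scalars J) (map (residue_class J) (b # bs)) =
        Q.line_extension (scalars J) (residue_class J b) (Q.Span (scalars J) (map (residue_class J) bs))"
      by simp
    show ?case
      unfolding Span Cons.IH
    proof (intro equalityI subsetI)
      fix x
      assume "x \<in> Q.line_extension (scalars J) (residue_class J b)
        (residue_class J ` {\<Sum>l<length bs. Const (c l) * bs ! l |c. True})"
      then obtain k c where "x = residue_class J (Const k * b + (\<Sum>l<length bs. Const (c l) * bs ! l))"
        unfolding Q.line_extension_mem_iff scalars_def
        by (elim bexE imageE CollectE exE conjE) (simp only: residue_class_simps[OF J])
      then have "x = residue_class J (\<Sum>l<length (b # bs). Const (case_nat k c l) * (b # bs) ! l)"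
        unfolding sum nat.case .
      then show "x \<in> residue_class J ` {\<Sum>l<length (b # bs). Const (c l) * (b # bs) ! l |c. True}"
        by (rule image_eqI) (intro CollectI exI[of _ "case_nat k c"] conjI TrueI refl)
    next
      fix x
      assume "x \<in> residue_class J ` {\<Sum>l<length (b # bs). Const (c l) * (b # bs) ! l |c. True}"
      then obtain c where "x = residue_class J (Const (c 0) * b + (\<Sum>l<length bs. Const (c (Suc l)) * bs ! l))"
        unfolding sum by (elim imageE CollectE exE conjE) simp
      then have "x = residue_class J (Const (c 0)) \<otimes>\<^bsub>quot_alg J\<^esub> residue_class J b \<oplus>\<^bsub>quot_alg J\<^esub>
          residue_class J (\<Sum>l<length bs. Const (c (Suc l)) * bs ! l)"
        by (simp add: residue_class_simps[OF J])
      then show "x \<in> Q.line_extension (scalars J) (residue_class J b)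
        (residue_class J ` {\<Sum>l<length bs. Const (c l) * bs ! l |c. True})"
        unfolding Q.line_extension_mem_iff scalars_def
        by (intro bexI[of _ "residue_class J (Const (c 0))"]
            bexI[of _ "residue_class J (\<Sum>l<length bs. Const (c (Suc l)) * bs ! l)"])
          (auto intro!: imageI exI[of _ "\<lambda>l. c (Suc l)"])
    qed
  }
qed

text \<open>Membership in \<open>J\<close> constrains only coefficients outside \<open>U\<close>, so
  these coefficients are well defined on residue classes. They separate the standard monomials, and
  every form is congruent to the sum of its standard terms.\<close>

lemma basis_of_piece_monomials:
  assumes U: "up_closed U" and J: "J = {f :: (3, 'k::field) mpol. supp f \<subseteq> U}"
    and ms: "distinct ms" "set ms = {m. m \<notin> U \<and> mdeg m = i}"
  shows "basis_of_piece J i (map (\<lambda>m. trm m 1) ms)"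
  unfolding basis_of_piece_def
proof (intro conjI)
  have id: "ideal J typ_ring" unfolding J by (rule ideal_supp_subset[OF U])
  interpret Q: ring "quot_alg J" by (rule ring_quot_alg[OF id])
  have J_iff: "f \<in> J \<longleftrightarrow> (\<forall>m. m \<notin> U \<longrightarrow> coef f m = 0)" for f
    unfolding J by (rule mem_supp_subset_iff)
  have sum: "(\<Sum>l<length (map (\<lambda>m. trm m 1) xs). Const (c l) * map (\<lambda>m. trm m 1) xs ! l) =
      (\<Sum>l<length xs. Const (c l) * trm (xs ! l) (1::'k))" for c and xs :: "(3 \<Rightarrow>\<^sub>0 nat) list"
    by simp
  show hom: "\<forall>b\<in>set (map (\<lambda>m. trm m 1) ms). homogeneous i (b :: (3, 'k) mpol)"
    using ms by (auto simp: homogeneous_def)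
  have "Q.independent (scalars J) (map (residue_class J) (map (\<lambda>m. trm m 1) xs))"
    if "distinct xs" "set xs \<inter> U = {}" for xs
    using that
  proof (induction xs)
    case (Cons m xs)
    have "residue_class J (trm m 1) \<notin> Q.Span (scalars J) (map (residue_class J) (map (\<lambda>m. trm m 1) xs))"
    proof
      assume "residue_class J (trm m 1) \<in> Q.Span (scalars J) (map (residue_class J) (map (\<lambda>m. trm m 1) xs))"
      then obtain c where "trm m 1 - (\<Sum>l<length xs. Const (c l) * trm (xs ! l) (1::'k)) \<in> J"
        unfolding Span_residue_class[OF id] by (auto simp: residue_class_eq_iff[OF id])
      then show False
        using Cons.prems coef_sum_trms_eq_0[of m xs c] by (auto simp: J_iff lookup_minus)
    qed
    then show ?case using Cons residue_class_simps(5)[OF id] by (auto intro!: Q.li_Cons)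
  qed simp
  then show "Q.independent (scalars J) (map (residue_class J) (map (\<lambda>m. trm m 1) ms))"
    using ms by auto
  show "Q.Span (scalars J) (map (residue_class J) (map (\<lambda>m. trm m 1) ms)) = graded_piece J i"
    unfolding Span_residue_class[OF id] graded_piece_def sum
  proof (intro equalityI subsetI; elim imageE; clarify)
    fix c
    have "homogeneous i (\<Sum>l<length ms. Const (c l) * trm (ms ! l) (1::'k))"
      using coef_sum_trms_eq_0[of _ ms c] ms(2) by (fastforce simp: homogeneous_def in_keys_iff)
    then show "residue_class J (\<Sum>l<length ms. Const (c l) * trm (ms ! l) 1) \<in>
        residue_class J ` {f. homogeneous i f}" by blast
  next
    fix f :: "(3, 'k) mpol" assume f: "homogeneous i f"
    have "f - (\<Sum>l<length ms. Const (coef f (ms ! l)) * trm (ms ! l) 1) \<in> J"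
      unfolding J_iff
    proof (intro allI impI)
      fix m assume m: "m \<notin> U"
      show "coef (f - (\<Sum>l<length ms. Const (coef f (ms ! l)) * trm (ms ! l) 1)) m = 0"
      proof (cases "m \<in> set ms")
        case True
        then obtain l where "l < length ms" "m = ms ! l" by (metis in_set_conv_nth)
        then show ?thesis using coef_sum_trms[OF ms(1), of l "\<lambda>l. coef f (ms ! l)"] by (simp add: lookup_minus)
      next
        case False
        then have "coef f m = 0" using m ms(2) f by (auto simp: homogeneous_def in_keys_iff)
        then show ?thesis using coef_sum_trms_eq_0[OF False] by (simp add: lookup_minus)
      qed
    qed
    then have "residue_class J f = residue_class J (\<Sum>l<length ms. Const (coef f (ms ! l)) * trm (ms ! l) 1)"
      by (simp add: residue_class_eq_iff[OF id])
    then show "residue_class J f \<in> residue_class J ` {\<Sum>l<length ms. Const (c l) * trm (ms ! l) 1 |c. True}"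
      by (auto intro!: image_eqI[of _ _ "\<Sum>l<length ms. Const (coef f (ms ! l)) * trm (ms ! l) 1"])
  qed
qed

text \<open>Since \<open>conic_ideal_at\<close> admits every choice of bases, this is what fixes the
  shape of all the matrices at once.\<close>

lemma basis_of_piece_length_eq:
  assumes J: "ideal J typ_ring" "1 \<notin> J" and "basis_of_piece J i bs" "basis_of_piece J i cs"
  shows "length bs = length cs"
proof -
  interpret Q: ring "quot_alg J" by (rule ring_quot_alg[OF J(1)])
  note K = scalars_subfield[OF J]
  have "length xs \<le> length ys" if "basis_of_piece J i xs" "basis_of_piece J i ys" for xs ys
  proof -
    have "set (map (residue_class J) xs) \<subseteq> Q.Span (scalars J) (map (residue_class J) xs)"
      using residue_class_simps(5)[OF J(1)] by (intro Q.Span_base_incl[OF K]) auto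
    then show ?thesis
      using Q.independent_length_le[OF K, of "map (residue_class J) xs" "map (residue_class J) ys"] that
      by (simp add: basis_of_piece_def)
  qed
  then show ?thesis using assms by (meson le_antisym)
qed

text \<open>\<open>p\<close> is the coordinate vector of the class of the monomial \<open>m\<close>
  in an arbitrary basis. Such vectors serve as test vectors showing that coefficient functionals,
  written in that basis, are independent.\<close>

lemma basis_of_piece_coefs:
  assumes U: "up_closed U" and J: "J = {f :: (3, 'k::field) mpol. supp f \<subseteq> U}"
    and bs: "basis_of_piece J i bs" and m: "mdeg m = i"
  shows "\<exists>p. \<forall>m'. m' \<notin> U \<longrightarrow> (\<Sum>l<length bs. p l * coef (bs ! l) m') = (1 when m = m')"
proof -
  have id: "ideal J typ_ring" unfolding J by (rule ideal_supp_subset[OF U])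
  have "homogeneous i (trm m (1::'k))" using m by (simp add: homogeneous_def)
  then have "residue_class J (trm m (1::'k)) \<in> ring.Span (quot_alg J) (scalars J) (map (residue_class J) bs)"
    using bs by (auto simp: basis_of_piece_def graded_piece_def)
  then obtain p where "trm m 1 - (\<Sum>l<length bs. Const (p l) * bs ! l) \<in> J"
    unfolding Span_residue_class[OF id] by (auto simp: residue_class_eq_iff[OF id])
  then have "(\<Sum>l<length bs. p l * coef (bs ! l) m') = (1 when m = m')" if "m' \<notin> U" for m'
    using that unfolding J mem_supp_subset_iff
    by (simp add: lookup_minus lookup_sum coef_Const_mult lookup_single)
  then show ?thesis by blast
qed

section \<open>Minors\<close>

lemma bij_betw_pick:
  assumes "finite S"
  shows "bij_betw (pick S) {..<card S} S"
proof -
  have inj: "inj_on (pick S) {..<card S}"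
    by (rule linorder_inj_onI) (auto dest: pick_mono_le)
  have "pick S ` {..<card S} \<subseteq> S" using pick_in_set_le by auto
  moreover have "card (pick S ` {..<card S}) = card S" using card_image[OF inj] by simp
  ultimately have "pick S ` {..<card S} = S" using assms by (metis card_subset_eq)
  then show ?thesis using inj by (simp add: bij_betw_def)
qed

lemma pick_lessThan: "i < k \<Longrightarrow> pick {..<k} i = i"
proof -
  assume "i < k"
  moreover from this have "{a \<in> {..<k}. a < i} = {..<i}" by auto
  ultimately show ?thesis using pick_card_in_set[of i "{..<k}"] by simp
qed

lemma submatrix_carrier:
  assumes "A \<in> carrier_mat n m" "rs \<subseteq> {..<n}" "cs \<subseteq> {..<m}"
  shows "submatrix A rs cs \<in> carrier_mat (card rs) (card cs)"
    and "i < card rs \<Longrightarrow> j < card cs \<Longrightarrow> submatrix A rs cs $$ (i, j) = A $$ (pick rs i, pick cs j)"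
proof -
  have "{i. i < dim_row A \<and> i \<in> rs} = rs" "{j. j < dim_col A \<and> j \<in> cs} = cs" using assms by auto
  then show "submatrix A rs cs \<in> carrier_mat (card rs) (card cs)"
    "i < card rs \<Longrightarrow> j < card cs \<Longrightarrow> submatrix A rs cs $$ (i, j) = A $$ (pick rs i, pick cs j)"
    by (simp_all add: submatrix_def)
qed

lemma map_mat_submatrix:
  assumes "A \<in> carrier_mat n m" "rs \<subseteq> {..<n}" "cs \<subseteq> {..<m}"
  shows "map_mat h (submatrix A rs cs) = submatrix (map_mat h A) rs cs"
proof -
  have A: "map_mat h A \<in> carrier_mat n m" using assms by simp
  have p: "pick rs i < n" "pick cs j < m" if "i < card rs" "j < card cs" for i j
    using that assms pick_in_set_le by blast+
  show ?thesis
    using assms submatrix_carrier(1)[OF assms] submatrix_carrier(1)[OF A assms(2,3)]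
    by (intro eq_matI) (auto simp: submatrix_carrier(2)[OF assms] submatrix_carrier(2)[OF A assms(2,3)] p)
qed

text \<open>\<open>\<gamma>\<close> is a left null vector of \<open>A\<close>. Being supported on
  the selected rows, it restricts to a nonzero left null vector of the square submatrix.\<close>

lemma det_submatrix_eq_0:
  fixes A :: "'a::idom mat"
  assumes A: "A \<in> carrier_mat n m" and rs: "rs \<subseteq> {..<n}" and cs: "cs \<subseteq> {..<m}" "card rs = card cs"
    and nz: "l < n" "\<gamma> l \<noteq> 0" and supp: "\<And>l. l < n \<Longrightarrow> l \<notin> rs \<Longrightarrow> \<gamma> l = 0"
    and null: "\<And>j. j < m \<Longrightarrow> (\<Sum>l<n. \<gamma> l * A $$ (l, j)) = 0"
  shows "det (submatrix A rs cs) = 0"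
proof -
  let ?k = "card rs" and ?N = "submatrix A rs cs"
  define v where "v = vec ?k (\<lambda>i. \<gamma> (pick rs i))"
  have N: "?N \<in> carrier_mat ?k ?k" using submatrix_carrier(1)[OF A rs cs(1)] cs(2) by simp
  have fin: "finite rs" using rs finite_subset by blast
  note bij = bij_betw_pick[OF fin]
  have "transpose_mat ?N *\<^sub>v v = 0\<^sub>v ?k"
  proof (rule eq_vecI)
    fix j assume "j < dim_vec (0\<^sub>v ?k)"
    then have j: "j < ?k" by simp
    then have "pick cs j < m" using cs pick_in_set_le[of j cs] by auto
    have "(transpose_mat ?N *\<^sub>v v) $ j = (\<Sum>i<?k. \<gamma> (pick rs i) * A $$ (pick rs i, pick cs j))"
      using j N submatrix_carrier(2)[OF A rs cs(1)] cs(2)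
      by (auto simp: v_def scalar_prod_def lessThan_atLeast0 mult.commute intro!: sum.cong)
    also have "\<dots> = (\<Sum>l\<in>rs. \<gamma> l * A $$ (l, pick cs j))"
      by (rule sum.reindex_bij_betw[OF bij])
    also have "\<dots> = (\<Sum>l<n. \<gamma> l * A $$ (l, pick cs j))"
      using rs supp by (intro sum.mono_neutral_left) auto
    finally show "(transpose_mat ?N *\<^sub>v v) $ j = 0\<^sub>v ?k $ j"
      using null[OF \<open>pick cs j < m\<close>] j by simp
  qed (use N in auto)
  moreover have "v \<noteq> 0\<^sub>v ?k"
  proof -
    have "l \<in> rs" using nz supp by blast
    then obtain i where i: "i < ?k" "pick rs i = l" using bij by (force simp: bij_betw_def)
    then have "v $ i \<noteq> 0" using nz by (simp add: v_def)
    then show ?thesis using i by auto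
  qed
  moreover have "v \<in> carrier_vec ?k" by (simp add: v_def)
  ultimately have "det (transpose_mat ?N) = 0"
    using det_0_iff_vec_prod_zero[OF transpose_carrier_mat[THEN iffD2, OF N]] by blast
  then show ?thesis using det_transpose[OF N] by simp
qed

text \<open>At most one row is omitted, and some nonzero combination of two independent null vectors
  vanishes there. Independence is witnessed by the test vectors \<open>p\<close> and
  \<open>q\<close>. The pairing of \<open>q\<close> with \<open>\<beta>\<close> is only required to
  be nonzero, because in the application it is a variable of \<open>S\<close>.\<close>

lemma det_submatrix_eq_0_two_null_vectors:
  fixes A :: "'a::idom mat"
  assumes A: "A \<in> carrier_mat n m" and rs: "rs \<subseteq> {..<n}" and cs: "cs \<subseteq> {..<m}" "card rs = card cs"
    and card: "n \<le> card rs + 1"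
    and \<alpha>: "\<And>j. j < m \<Longrightarrow> (\<Sum>l<n. \<alpha> l * A $$ (l, j)) = 0"
    and \<beta>: "\<And>j. j < m \<Longrightarrow> (\<Sum>l<n. \<beta> l * A $$ (l, j)) = 0"
    and p: "(\<Sum>l<n. p l * \<alpha> l) = 1" "(\<Sum>l<n. p l * \<beta> l) = 0"
    and q: "(\<Sum>l<n. q l * \<alpha> l) = 0" "(\<Sum>l<n. q l * \<beta> l) \<noteq> 0"
  shows "det (submatrix A rs cs) = 0"
proof -
  have fin: "finite rs" using rs finite_subset by blast
  \<comment> \<open>\<open>r\<close> is the omitted row, or arbitrary if no row is omitted.\<close>
  obtain r where r: "\<And>l. l < n \<Longrightarrow> l \<notin> rs \<Longrightarrow> l = r"
  proof -
    have "card ({..<n} - rs) \<le> 1" using card card_Diff_subset[OF fin rs] by simp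
    then show thesis using that card_le_Suc0_iff_eq[of "{..<n} - rs"]
      by (metis DiffI One_nat_def finite_Diff finite_lessThan lessThan_iff)
  qed
  show ?thesis
  proof (cases "\<alpha> r = 0 \<and> \<beta> r = 0")
    case True
    have "\<exists>l<n. \<alpha> l \<noteq> 0"
    proof (rule ccontr)
      assume "\<not> (\<exists>l<n. \<alpha> l \<noteq> 0)"
      then have "(\<Sum>l<n. p l * \<alpha> l) = 0" by (intro sum.neutral) auto
      then show False using p(1) by simp
    qed
    then obtain l where "l < n" "\<alpha> l \<noteq> 0" by blast
    then show ?thesis
      by (rule det_submatrix_eq_0[OF A rs cs]) (use True r \<alpha> in auto)
  next
    case False
    \<comment> \<open>Chosen to vanish at \<open>r\<close>. Pairing with \<open>p\<close> gives
      \<open>\<beta> r\<close>, and pairing with \<open>q\<close> gives \<open>\<alpha> r\<close>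
      times a nonzero element up to sign; since one of the two values is nonzero, so is
      \<open>\<gamma>\<close>.\<close>
    define \<gamma> where "\<gamma> l = \<beta> r * \<alpha> l - \<alpha> r * \<beta> l" for l
    have lin: "(\<Sum>l<n. x l * \<gamma> l) = \<beta> r * (\<Sum>l<n. x l * \<alpha> l) - \<alpha> r * (\<Sum>l<n. x l * \<beta> l)" for x
      by (simp add: \<gamma>_def sum_distrib_left algebra_simps flip: sum_subtractf)
    have "\<exists>l<n. \<gamma> l \<noteq> 0"
    proof (rule ccontr)
      assume "\<not> (\<exists>l<n. \<gamma> l \<noteq> 0)"
      then have "(\<Sum>l<n. p l * \<gamma> l) = 0" "(\<Sum>l<n. q l * \<gamma> l) = 0" by (auto intro!: sum.neutral)
      then show False using lin[of p] lin[of q] p q False by auto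
    qed
    then obtain l where "l < n" "\<gamma> l \<noteq> 0" by blast
    then show ?thesis
    proof (rule det_submatrix_eq_0[OF A rs cs])
      show "\<gamma> l = 0" if "l < n" "l \<notin> rs" for l
        using r[OF that] by (simp add: \<gamma>_def)
      show "(\<Sum>l<n. \<gamma> l * A $$ (l, j)) = 0" if "j < m" for j
        using lin[of "\<lambda>l. A $$ (l, j)"] \<alpha>[OF that] \<beta>[OF that] by (simp add: mult.commute)
    qed
  qed
qed


section \<open>The generic conic\<close>

lemma Const_1: "Const 1 = 1"
  by (simp add: Const_def)

lemma Const_hom: "Const (a + b) = (Const a + Const b :: ('v, 'a::comm_ring_1) mpol)"
    "Const (a * b) = (Const a * Const b :: ('v, 'a) mpol)" "Const 0 = (0 :: ('v, 'a) mpol)"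
  by (simp_all add: Const_def single_add mult_single)

lemma Const_sum: "Const (\<Sum>x\<in>A. f x) = (\<Sum>x\<in>A. Const (f x) :: ('v, 'a::comm_ring_1) mpol)"
  by (induction A rule: infinite_finite_induct) (simp_all add: Const_hom)

lemma generic_conic_trms:
  "generic_conic = trm (expo 1 1 + expo 1 1) (Var 1) + trm (expo 1 1 + expo 2 1) (Var 2) +
     trm (expo 1 1 + expo 3 1) (Var 3) + trm (expo 2 1 + expo 2 1) (Var 4) +
     trm (expo 2 1 + expo 3 1) (Var 5) + trm (expo 3 1 + expo 3 1) (Var 6)"
proof -
  have "Const c * (Var v * Var w) = trm (expo v 1 + expo w 1) c" for c :: "(6, 'a) mpol" and v w :: 3
    by (simp add: Var_def Const_def mult_single)
  then show ?thesis unfolding generic_conic_def by (simp only:)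
qed

lemma coef_trm_mult_eq_0_lookup:
  fixes g :: "('v, 'a::comm_ring_1) mpol"
  assumes "Poly_Mapping.lookup m v < Poly_Mapping.lookup k v"
  shows "coef (trm k a * g) m = 0"
  using assms by (intro coef_trm_mult_eq_0) (auto simp: lookup_add)

text \<open>Among the six quadratic monomials only \<open>x3^2\<close> divides a power of
  \<open>x3\<close>. In the two lemmas that follow, only \<open>x1 x3\<close> (respectively
  \<open>x2 x3\<close>) and \<open>x3^2\<close> divide the target. Setting \<open>a6 = 0\<close>
  thus kills this coefficient and makes the other two multiples of one and the same coefficient of
  \<open>g\<close>.\<close>

lemma coef_generic_conic_z:
  "coef (generic_conic * g) (expo 3 (n + 2)) = Var 6 * coef g (expo 3 n)"
proof -
  have eq: "expo 3 (n + 2) = (expo 3 1 + expo 3 1) + expo (3::3) n"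
    by (simp flip: Poly_Mapping.single_add)
  have 1: "coef (trm (expo 1 1 + k) a * g) (expo 3 (n + 2)) = 0" for k a
    by (rule coef_trm_mult_eq_0_lookup[of _ 1]) (simp add: lookup_add lookup_single)
  have 2: "coef (trm (expo 2 1 + k) a * g) (expo 3 (n + 2)) = 0" for k a
    by (rule coef_trm_mult_eq_0_lookup[of _ 2]) (simp add: lookup_add lookup_single)
  have 3: "coef (trm (expo 3 1 + expo 3 1) a * g) (expo 3 (n + 2)) = a * coef g (expo 3 n)" for a
    unfolding eq by (rule coef_trm_mult)
  show ?thesis
    unfolding generic_conic_trms distrib_right lookup_add 1 2 3 by simp
qed

lemma coef_generic_conic_xz:
  "coef (generic_conic * g) (expo 1 1 + expo 3 (n + 2)) =
     Var 3 * coef g (expo 3 (n + 1)) + Var 6 * coef g (expo 1 1 + expo 3 n)"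
  (is "coef _ ?m = _")
proof -
  have eq3: "?m = (expo 1 1 + expo 3 1) + expo (3::3) (n + 1)"
    by (simp add: add.assoc flip: Poly_Mapping.single_add)
  have eq6: "?m = (expo 3 1 + expo 3 1) + (expo (1::3) 1 + expo (3::3) n)"
    by (rule exponents_3_eqI) (simp_all add: lookup_add lookup_single)
  have 1: "coef (trm (expo 1 1 + expo 1 1) a * g) ?m = 0" for a
    by (rule coef_trm_mult_eq_0_lookup[of _ 1]) (simp add: lookup_add lookup_single)
  have 2: "coef (trm (expo 2 1 + k) a * g) ?m = 0" for k a
    by (rule coef_trm_mult_eq_0_lookup[of _ 2]) (simp add: lookup_add lookup_single)
  have 12: "coef (trm (expo 1 1 + expo 2 1) a * g) ?m = 0" for a
    by (rule coef_trm_mult_eq_0_lookup[of _ 2]) (simp add: lookup_add lookup_single)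
  have 3: "coef (trm (expo 1 1 + expo 3 1) a * g) ?m = a * coef g (expo 3 (n + 1))" for a
    unfolding eq3 by (rule coef_trm_mult)
  have 6: "coef (trm (expo 3 1 + expo 3 1) a * g) ?m = a * coef g (expo 1 1 + expo 3 n)" for a
    unfolding eq6 by (rule coef_trm_mult)
  show ?thesis
    unfolding generic_conic_trms distrib_right lookup_add 1 2 12 3 6 by simp
qed

lemma coef_generic_conic_yz:
  "coef (generic_conic * g) (expo 2 1 + expo 3 (n + 2)) =
     Var 5 * coef g (expo 3 (n + 1)) + Var 6 * coef g (expo 2 1 + expo 3 n)"
  (is "coef _ ?m = _")
proof -
  have eq5: "?m = (expo 2 1 + expo 3 1) + expo (3::3) (n + 1)"
    by (simp add: add.assoc flip: Poly_Mapping.single_add)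
  have eq6: "?m = (expo 3 1 + expo 3 1) + (expo (2::3) 1 + expo (3::3) n)"
    by (rule exponents_3_eqI) (simp_all add: lookup_add lookup_single)
  have 1: "coef (trm (expo 1 1 + k) a * g) ?m = 0" for k a
    by (rule coef_trm_mult_eq_0_lookup[of _ 1]) (simp add: lookup_add lookup_single)
  have 2: "coef (trm (expo 2 1 + expo 2 1) a * g) ?m = 0" for a
    by (rule coef_trm_mult_eq_0_lookup[of _ 2]) (simp add: lookup_add lookup_single)
  have 5: "coef (trm (expo 2 1 + expo 3 1) a * g) ?m = a * coef g (expo 3 (n + 1))" for a
    unfolding eq5 by (rule coef_trm_mult)
  have 6: "coef (trm (expo 3 1 + expo 3 1) a * g) ?m = a * coef g (expo 2 1 + expo 3 n)" for a
    unfolding eq6 by (rule coef_trm_mult)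
  show ?thesis
    unfolding generic_conic_trms distrib_right lookup_add 1 2 5 6 by simp
qed

text \<open>Congruence modulo a monomial ideal concerns standard coefficients only. Each standard
  \<open>m\<close> gives one linear relation among the rows of \<open>M\<close>, namely the
  coefficient functional at \<open>m\<close> written in the basis \<open>cs\<close>.\<close>

lemma represents_conic_coef:
  fixes d1 d2 d3 :: nat
  defines "J \<equiv> monomial_ci_ideal d1 d2 d3 :: (3, 'k::field) mpol set"
  shows "represents_conic J bs cs M \<longleftrightarrow> M \<in> carrier_mat (length cs) (length bs) \<and>
    (\<forall>j<length bs. \<forall>m. m \<notin> ci_exponents d1 d2 d3 \<longrightarrow>
       coef (generic_conic * lift_coeffs (bs ! j)) m = (\<Sum>l<length cs. M $$ (l, j) * Const (coef (cs ! l) m)))"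
proof -
  have id: "ideal (extended_ideal J) typ_ring" unfolding extended_ideal_def by (rule ideal_ideal_gen)
  show ?thesis
    unfolding represents_conic_def residue_class_eq_iff[OF id]
    unfolding J_def extended_ideal_ci mem_supp_subset_iff
    by (simp add: lookup_minus lookup_sum coef_Const_mult coef_lift_coeffs)
qed

lemma restrict_supp_Const: "face F \<Longrightarrow> restrict_supp F (Const c) = Const c"
  by (simp add: Const_def restrict_supp_trm face_def)

lemma restrict_supp_Var: "restrict_supp F (Var v) = (if expo v 1 \<in> F then Var v else 0)"
  by (simp add: Var_def restrict_supp_trm)

section \<open>Standard monomials\<close>

definition std_exponents :: "nat \<Rightarrow> nat \<Rightarrow> nat \<Rightarrow> nat \<Rightarrow> (3 \<Rightarrow>\<^sub>0 nat) set" where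
  "std_exponents d1 d2 d3 i = {m. m \<notin> ci_exponents d1 d2 d3 \<and> mdeg m = i}"

lemma mem_std_exponents_iff:
  "m \<in> std_exponents d1 d2 d3 i \<longleftrightarrow> Poly_Mapping.lookup m 1 < d1 \<and> Poly_Mapping.lookup m 2 < d2 \<and>
     Poly_Mapping.lookup m 3 < d3 \<and>
     Poly_Mapping.lookup m 1 + Poly_Mapping.lookup m 2 + Poly_Mapping.lookup m 3 = i"
  by (auto simp: std_exponents_def ci_exponents_def mdeg_3)

lemma finite_std_exponents: "finite (std_exponents d1 d2 d3 i)"
proof (rule inj_on_finite)
  let ?f = "\<lambda>m :: 3 \<Rightarrow>\<^sub>0 nat. (Poly_Mapping.lookup m 1, Poly_Mapping.lookup m 2, Poly_Mapping.lookup m 3)"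
  show "inj_on ?f (std_exponents d1 d2 d3 i)"
    by (rule inj_onI) (auto intro!: exponents_3_eqI)
  show "?f ` std_exponents d1 d2 d3 i \<subseteq> {..<d1} \<times> {..<d2} \<times> {..<d3}"
    by (auto simp: mem_std_exponents_iff)
qed simp

lemma basis_of_piece_std:
  assumes "distinct ms" "set ms = std_exponents d1 d2 d3 i"
  shows "basis_of_piece (monomial_ci_ideal d1 d2 d3 :: (3, 'k::field) mpol set) i (map (\<lambda>m. trm m 1) ms)"
  using assms
  by (intro basis_of_piece_monomials[OF up_closed_ci_exponents])
    (simp_all add: monomial_ci_ideal_def ideal_gen_Var_powers std_exponents_def)

section \<open>Multiplication by the square of the third variable\<close>

lemma lookup_add_zz: "Poly_Mapping.lookup (expo 3 2 + m) v =
    (if v = 3 then 2 + Poly_Mapping.lookup m v else Poly_Mapping.lookup m (v :: 3))"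
  by (simp add: lookup_add lookup_single when_def)

lemma add_zz_minus: "2 \<le> Poly_Mapping.lookup m 3 \<Longrightarrow> expo 3 2 + (m - expo 3 2) = (m :: 3 \<Rightarrow>\<^sub>0 nat)"
  by (rule exponents_3_eqI) (simp_all add: lookup_add lookup_minus lookup_single)

text \<open>In degree \<open>i + 2 < d3\<close> the exponent of the third variable cannot reach
  \<open>d3\<close>.\<close>

lemma add_zz_std_exponents_subset:
  assumes "i + 3 \<le> d3"
  shows "(+) (expo 3 2) ` std_exponents d1 d2 d3 i \<subseteq> std_exponents d1 d2 d3 (i + 2)"
  using assms by (auto simp: mem_std_exponents_iff lookup_add_zz)

text \<open>The first two exponents add up to at most \<open>d1 + d2 - 2\<close>, which leaves at
  least 2 for the third.\<close>

lemma add_zz_std_exponents_superset: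
  assumes "d1 + d2 \<le> i + 2"
  shows "std_exponents d1 d2 d3 (i + 2) \<subseteq> (+) (expo 3 2) ` std_exponents d1 d2 d3 i"
proof
  fix m assume m: "m \<in> std_exponents d1 d2 d3 (i + 2)"
  then have "2 \<le> Poly_Mapping.lookup m 3" using assms by (auto simp: mem_std_exponents_iff)
  then have "expo 3 2 + (m - expo 3 2) = m" by (rule add_zz_minus)
  moreover have "m - expo 3 2 \<in> std_exponents d1 d2 d3 i"
    using m \<open>2 \<le> _\<close> by (auto simp: mem_std_exponents_iff lookup_minus lookup_single)
  ultimately show "m \<in> (+) (expo 3 2) ` std_exponents d1 d2 d3 i" by (metis imageI)
qed

text \<open>Matching pairs are listed first and in the same order, so that the matrix of the map
  induced by \<open>f\<close> has an identity matrix as its leading maximal square block.\<close>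

lemma compatible_enumerations:
  fixes f :: "'a \<Rightarrow> 'a"
  assumes "finite A" "finite B" "inj f" and sub: "f ` A \<subseteq> B \<or> B \<subseteq> f ` A"
  obtains as bs where "distinct as" "set as = A" "distinct bs" "set bs = B"
    "\<And>l. l < length as \<Longrightarrow> l < length bs \<Longrightarrow> bs ! l = f (as ! l)"
proof (cases "f ` A \<subseteq> B")
  case True
  obtain as where as: "distinct as" "set as = A" using finite_distinct_list assms(1) by metis
  obtain cs where cs: "distinct cs" "set cs = B - f ` A" using finite_distinct_list assms(2) by (metis finite_Diff)
  show thesis
    by (rule that[of as "map f as @ cs"])
      (use as cs True \<open>inj f\<close> in \<open>auto simp: distinct_map nth_append intro: inj_on_subset\<close>)
next
  case False
  define A' where "A' = A \<inter> f -` B"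
  have A': "finite A'" "f ` A' = B" using sub False assms(1) by (auto simp: A'_def)
  obtain as where as: "distinct as" "set as = A'" using finite_distinct_list A' by metis
  obtain cs where cs: "distinct cs" "set cs = A - A'" using finite_distinct_list assms(1) by (metis finite_Diff)
  show thesis
    by (rule that[of "as @ cs" "map f as"])
      (use as cs A' \<open>inj f\<close> in \<open>auto simp: distinct_map nth_append A'_def intro: inj_on_subset\<close>)
qed

text \<open>Setting every variable of \<open>S\<close> except \<open>a6\<close> to 0 turns the
  generic conic into \<open>a6 x3^2\<close>. In matching monomial bases the leading block becomes
  \<open>a6\<close> times the identity, so the leading maximal minor restricts to a power of
  \<open>a6\<close>. If one of the two pieces is zero, that minor is the empty determinant
  1.\<close>

lemma conic_ideal_at_nonzero:
  fixes d1 d2 d3 :: nat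
  defines "J \<equiv> monomial_ci_ideal d1 d2 d3 :: (3, 'k::field) mpol set"
  assumes "d3 = d1 + d2"
  shows "\<exists>f\<in>conic_ideal_at J i. f \<noteq> 0"
proof -
  let ?T = "std_exponents d1 d2 d3"
  \<comment> \<open>The conditions \<open>i + 3 <= d3\<close> and \<open>d1 + d2 <= i + 2\<close>
    are complementary precisely because \<open>d3 = d1 + d2\<close>.\<close>
  have sub: "(+) (expo 3 2) ` ?T i \<subseteq> ?T (i + 2) \<or> ?T (i + 2) \<subseteq> (+) (expo 3 2) ` ?T i"
    using assms(2) add_zz_std_exponents_subset[of i d3 d1 d2] add_zz_std_exponents_superset[of d1 d2 i d3]
    by (cases "i + 3 \<le> d3") auto
  have inj: "inj ((+) (expo (3::3) (2::nat)))" by (rule injI) simp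
  obtain ms ms' where ms: "distinct ms" "set ms = ?T i" and ms': "distinct ms'" "set ms' = ?T (i + 2)"
    and match: "\<And>l. l < length ms \<Longrightarrow> l < length ms' \<Longrightarrow> ms' ! l = expo 3 2 + ms ! l"
    by (rule compatible_enumerations[OF finite_std_exponents finite_std_exponents inj sub]) (rule that, simp_all)
  define bs cs where "bs = map (\<lambda>m. trm m (1::'k)) ms" and "cs = map (\<lambda>m. trm m (1::'k)) ms'"
  define entry :: "(3 \<Rightarrow>\<^sub>0 nat) \<Rightarrow> (3 \<Rightarrow>\<^sub>0 nat) \<Rightarrow> (6, 'k) mpol"
    where "entry m' m = coef (generic_conic * trm m 1) m'" for m' m
  define M where "M = mat (length ms') (length ms) (\<lambda>(l, j). entry (ms' ! l) (ms ! j))"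
  have entry: "entry m' m = (Var 1 when expo 1 1 + expo 1 1 + m = m') + (Var 2 when expo 1 1 + expo 2 1 + m = m') +
     (Var 3 when expo 1 1 + expo 3 1 + m = m') + (Var 4 when expo 2 1 + expo 2 1 + m = m') +
     (Var 5 when expo 2 1 + expo 3 1 + m = m') + (Var 6 when expo 3 1 + expo 3 1 + m = m')" for m m'
    unfolding entry_def generic_conic_trms
    by (simp only: distrib_right mult_single lookup_add lookup_single mult_1_right)
  have "represents_conic J bs cs M"
    unfolding J_def represents_conic_coef
  proof (intro conjI allI impI)
    show "M \<in> carrier_mat (length cs) (length bs)" by (simp add: M_def bs_def cs_def)
    fix j m assume j: "j < length bs" and m: "m \<notin> ci_exponents d1 d2 d3"
    have "coef (generic_conic * lift_coeffs (bs ! j)) m = entry m (ms ! j)"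
      using j by (simp add: bs_def lift_coeffs_trm Const_1 entry_def)
    also have "\<dots> = (\<Sum>l<length ms'. if ms' ! l = m then entry (ms' ! l) (ms ! j) else 0)"
    proof (cases "m \<in> set ms'")
      case True
      then obtain k where k: "k < length ms'" "ms' ! k = m" by (metis in_set_conv_nth)
      have "(\<Sum>l<length ms'. if ms' ! l = m then entry (ms' ! l) (ms ! j) else 0) =
          (\<Sum>l<length ms'. if l = k then entry m (ms ! j) else 0)"
      proof (rule sum.cong[OF refl])
        fix l assume "l \<in> {..<length ms'}"
        then have "ms' ! l = m \<longleftrightarrow> l = k" using k nth_eq_iff_index_eq[OF ms'(1), of l k] by simp
        then show "(if ms' ! l = m then entry (ms' ! l) (ms ! j) else 0) = (if l = k then entry m (ms ! j) else 0)"
          by (cases "l = k") auto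
      qed
      also have "\<dots> = entry m (ms ! j)" using k(1) by (simp only: sum.delta finite_lessThan lessThan_iff if_True)
      finally show ?thesis by (rule sym)
    next
      case False
      \<comment> \<open>A standard monomial missing from \<open>ms'\<close> has degree other than
        \<open>i + 2\<close>, whereas all terms of the conic times \<open>ms ! j\<close> have that
        degree.\<close>
      have "ms ! j \<in> set ms" using j by (simp add: bs_def)
      then have "mdeg (ms ! j) = i" unfolding ms(2) by (simp add: std_exponents_def)
      moreover have "mdeg m \<noteq> i + 2" using False m unfolding ms'(2) by (simp add: std_exponents_def)
      ultimately have neq: "(expo v 1 + expo w 1 + ms ! j = m) = False" for v w
        using mdeg_add[of "expo v 1 + expo w 1" "ms ! j"] mdeg_add[of "expo v 1" "expo w 1"] by auto
      have "entry m (ms ! j) = 0" unfolding entry neq by simp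
      moreover have "(\<Sum>l<length ms'. if ms' ! l = m then entry (ms' ! l) (ms ! j) else 0) = 0"
        using False by (intro sum.neutral) auto
      ultimately show ?thesis by simp
    qed
    also have "\<dots> = (\<Sum>l<length cs. M $$ (l, j) * Const (coef (cs ! l) m))"
      using j by (intro sum.cong)
        (auto simp: M_def bs_def cs_def lookup_single when_def Const_hom Const_1)
    finally show "coef (generic_conic * lift_coeffs (bs ! j)) m = (\<Sum>l<length cs. M $$ (l, j) * Const (coef (cs ! l) m))" .
  qed
  moreover have "basis_of_piece J i bs" "basis_of_piece J (i + 2) cs"
    unfolding J_def bs_def cs_def using ms ms' by (simp_all add: basis_of_piece_std)
  ultimately have gens: "maximal_minors M \<subseteq> conic_ideal_at J i"
    unfolding conic_ideal_at_def
    by (intro order_trans[OF Union_upper ideal_gen_superset] CollectI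
        exI[of _ M] exI[of _ bs] exI[of _ cs] conjI refl)
  define k where "k = min (length ms') (length ms)"
  define N where "N = submatrix M {..<k} {..<k}"
  have M: "M \<in> carrier_mat (length ms') (length ms)" by (simp add: M_def)
  have "det N \<in> maximal_minors M"
    unfolding maximal_minors_def N_def using M
    by (intro CollectI exI[of _ "{..<k}"] conjI refl) (auto simp: k_def)
  moreover have "det N \<noteq> 0"
  proof -
    \<comment> \<open>The monomials in \<open>a6\<close> alone.\<close>
    define F where "F = {m :: 6 \<Rightarrow>\<^sub>0 nat. \<forall>v. v \<noteq> 6 \<longrightarrow> Poly_Mapping.lookup m v = 0}"
    have F: "face F" by (auto simp: face_def F_def lookup_add)
    interpret comm_ring_hom "restrict_supp F :: (6, 'k) mpol \<Rightarrow> _" by (rule restrict_supp_hom[OF F])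
    have sub: "{..<k} \<subseteq> {..<length ms'}" "{..<k} \<subseteq> {..<length ms}" by (auto simp: k_def)
    have N: "N \<in> carrier_mat k k" unfolding N_def using submatrix_carrier(1)[OF M sub] by simp
    have expo_F: "expo v 1 \<in> F \<longleftrightarrow> v = 6" for v by (auto simp: F_def lookup_single when_def)
    have zz: "expo (3::3) 1 + expo 3 1 = expo 3 2"
      by (simp add: numeral_2_eq_2 flip: Poly_Mapping.single_add)
    have restrict_entry: "restrict_supp F (entry m' m) = (Var 6 when expo 3 2 + m = m')" for m m'
    proof -
      have "restrict_supp F (Var v when P) = (if v = 6 then Var 6 when P else (0 :: (6, 'k) mpol))" for v P
        by (cases P) (simp_all add: restrict_supp_Var expo_F del: One_nat_def)
      then show ?thesis unfolding entry zz hom_add by (simp only:) simp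
    qed
    have "map_mat (restrict_supp F) N = Var 6 \<cdot>\<^sub>m 1\<^sub>m k"
    proof (rule eq_matI)
      fix l j assume "l < dim_row (Var 6 \<cdot>\<^sub>m 1\<^sub>m k :: (6, 'k) mpol mat)" "j < dim_col (Var 6 \<cdot>\<^sub>m 1\<^sub>m k :: (6, 'k) mpol mat)"
      then have lj: "l < k" "j < k" by auto
      then have "N $$ (l, j) = entry (expo 3 2 + ms ! l) (ms ! j)"
        using submatrix_carrier(2)[OF M sub, of l j] match[of l]
        by (simp add: N_def pick_lessThan M_def k_def)
      moreover have "ms ! j = ms ! l \<longleftrightarrow> l = j"
        using lj ms(1) by (auto simp: k_def nth_eq_iff_index_eq)
      ultimately show "map_mat (restrict_supp F) N $$ (l, j) = (Var 6 \<cdot>\<^sub>m 1\<^sub>m k) $$ (l, j)"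
        using lj N by (simp add: restrict_entry when_def)
    qed (use N in auto)
    then have "restrict_supp F (det N) = Var 6 ^ k"
      unfolding hom_det[of N, symmetric] by simp
    also have "\<dots> \<noteq> 0" unfolding Var_power by (simp flip: keys_eq_empty)
    finally show ?thesis by auto
  qed
  ultimately show ?thesis using gens by blast
qed

section \<open>The hyperplane of conics through the point (0 : 0 : 1)\<close>

text \<open>The target degree is \<open>d1 + d2 - 1\<close>, while the first two exponents
  contribute at most \<open>d1 + d2 - 2\<close>. A standard monomial not divisible by
  \<open>x3^2\<close> must therefore be \<open>x1^(d1-1) x2^(d2-1) x3\<close>, and all others come
  from degree \<open>i\<close>.\<close>

lemma card_std_exponents:
  assumes "d3 = d1 + d2" "0 < d1" "0 < d2" "i + 3 = d3"
  shows "card (std_exponents d1 d2 d3 (i + 2)) \<le> card (std_exponents d1 d2 d3 i) + 1"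
proof -
  let ?T = "std_exponents d1 d2 d3" and ?m = "expo 1 (d1 - 1) + expo 2 (d2 - 1) + expo (3::3) 1"
  have "?T (i + 2) \<subseteq> insert ?m ((+) (expo 3 2) ` ?T i)"
  proof
    fix m assume m: "m \<in> ?T (i + 2)"
    show "m \<in> insert ?m ((+) (expo 3 2) ` ?T i)"
    proof (cases "2 \<le> Poly_Mapping.lookup m 3")
      case True
      then have "m - expo 3 2 \<in> ?T i"
        using m by (auto simp: mem_std_exponents_iff lookup_minus lookup_single)
      then show ?thesis using add_zz_minus[OF True] by (metis imageI insertI2)
    next
      case False
      then have "m = ?m"
        using m assms by (intro exponents_3_eqI) (auto simp: mem_std_exponents_iff lookup_add lookup_single)
      then show ?thesis by simp
    qed
  qed
  then have "card (?T (i + 2)) \<le> card (insert ?m ((+) (expo 3 2) ` ?T i))"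
    by (intro card_mono) (simp_all add: finite_std_exponents)
  also have "\<dots> \<le> Suc (card ((+) (expo 3 2) ` ?T i))" by (rule card_insert_le_m1) auto
  also have "\<dots> \<le> card (?T i) + 1" using card_image_le[OF finite_std_exponents] by simp
  finally show ?thesis .
qed

lemma one_notin_ci_ideal:
  assumes "0 < d1" "0 < d2" "0 < d3"
  shows "1 \<notin> (monomial_ci_ideal d1 d2 d3 :: (3, 'k::field) mpol set)"
  unfolding monomial_ci_ideal_def ideal_gen_Var_powers using assms by (simp add: ci_exponents_def)

lemma length_basis_of_piece_ci:
  assumes "0 < d1" "0 < d2" "0 < d3"
    and "basis_of_piece (monomial_ci_ideal d1 d2 d3 :: (3, 'k::field) mpol set) i bs"
  shows "length bs = card (std_exponents d1 d2 d3 i)"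
proof -
  obtain ms where ms: "distinct ms" "set ms = std_exponents d1 d2 d3 i"
    using finite_distinct_list[OF finite_std_exponents] by metis
  have "length bs = length (map (\<lambda>m. trm m (1::'k)) ms)"
    using basis_of_piece_length_eq[OF _ one_notin_ci_ideal[OF assms(1-3)] assms(4) basis_of_piece_std[OF ms]]
      ideal_ideal_gen unfolding monomial_ci_ideal_def by blast
  then show ?thesis using distinct_card[OF ms(1)] ms(2) by simp
qed

text \<open>
  Modulo \<open>a\<^sub>6\<close> the functionals \<open>[x\<^sub>3\<^bsup>n+3\<^esup>]\<close> and
  \<open>a\<^sub>5 [x\<^sub>1 x\<^sub>3\<^bsup>n+2\<^esup>] - a\<^sub>3 [x\<^sub>2 x\<^sub>3\<^bsup>n+2\<^esup>]\<close> vanish on the image of the generic conic.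
\<close>

lemma conic_minors_hyperplane:
  fixes d1 d2 d3 :: nat
  defines "J \<equiv> monomial_ci_ideal d1 d2 d3 :: (3, 'k::field) mpol set"
  assumes d: "2 \<le> d1" "2 \<le> d2" "d3 = d1 + d2" "n + 4 = d3"
    and bs: "basis_of_piece J (n + 1) bs" and cs: "basis_of_piece J (n + 3) cs"
    and M: "represents_conic J bs cs M"
  shows "maximal_minors M \<subseteq> hyperplane 6"
proof
  let ?h = "restrict_supp {m. Poly_Mapping.lookup m 6 = 0} :: (6, 'k) mpol \<Rightarrow> _"
  interpret comm_ring_hom ?h by (rule restrict_supp_hom[OF face_hyperplane])
  have h_Const: "?h (Const c) = Const c" for c by (rule restrict_supp_Const[OF face_hyperplane])
  have h_Var: "?h (Var v) = (if v = 6 then 0 else Var v)" for v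
    by (simp add: restrict_supp_Var lookup_single when_def)
  let ?z = "expo (3::3) (n + 3)" and ?x = "expo 1 1 + expo (3::3) (n + 2)" and ?y = "expo 2 1 + expo (3::3) (n + 2)"
  \<comment> \<open>This is where \<open>d1\<close> and \<open>d2\<close> have to be at least 2:
    \<open>x1\<close> and \<open>x2\<close> must be nonzero in \<open>A\<close>. The powers of
    \<open>x3\<close> survive because \<open>n + 3 = d3 - 1\<close>.\<close>
  have std: "?z \<notin> ci_exponents d1 d2 d3" "?x \<notin> ci_exponents d1 d2 d3" "?y \<notin> ci_exponents d1 d2 d3"
    using d by (simp_all add: ci_exponents_def lookup_add lookup_single)
  have deg: "mdeg ?z = n + 3" "mdeg ?x = n + 3" by (simp_all add: mdeg_add)
  have Mc: "M \<in> carrier_mat (length cs) (length bs)"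
    and coefs: "\<And>j m. j < length bs \<Longrightarrow> m \<notin> ci_exponents d1 d2 d3 \<Longrightarrow>
      coef (generic_conic * lift_coeffs (bs ! j)) m = (\<Sum>l<length cs. M $$ (l, j) * Const (coef (cs ! l) m))"
    using M unfolding J_def represents_conic_coef by auto
  have row: "(\<Sum>l<length cs. Const (coef (cs ! l) m) * map_mat ?h M $$ (l, j)) =
      ?h (coef (generic_conic * lift_coeffs (bs ! j)) m)" if "j < length bs" "m \<notin> ci_exponents d1 d2 d3" for j m
    using Mc that(1) unfolding coefs[OF that] hom_sum
    by (intro sum.cong) (simp_all add: hom_mult h_Const mult.commute)
  let ?b = "\<lambda>j. Const (coef (bs ! j) (expo 3 (n + 1)))"
  have row_z: "(\<Sum>l<length cs. Const (coef (cs ! l) ?z) * map_mat ?h M $$ (l, j)) = 0" if "j < length bs" for j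
    using row[OF that std(1)] coef_generic_conic_z[of "lift_coeffs (bs ! j)" "n + 1"]
    by (simp add: hom_mult h_Var numeral_3_eq_3)
  have row_x: "(\<Sum>l<length cs. Const (coef (cs ! l) ?x) * map_mat ?h M $$ (l, j)) = Var 3 * ?b j" if "j < length bs" for j
    unfolding row[OF that std(2)] coef_generic_conic_xz
    by (simp add: hom_mult hom_add h_Var h_Const coef_lift_coeffs)
  have row_y: "(\<Sum>l<length cs. Const (coef (cs ! l) ?y) * map_mat ?h M $$ (l, j)) = Var 5 * ?b j" if "j < length bs" for j
    unfolding row[OF that std(3)] coef_generic_conic_yz
    by (simp add: hom_mult hom_add h_Var h_Const coef_lift_coeffs)
  \<comment> \<open>\<open>row_x\<close> and \<open>row_y\<close> produce multiples of the same
    \<open>?b j\<close>, so cross-multiplication by \<open>Var 5\<close> and \<open>Var 3\<close>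
    cancels them.\<close>
  define \<beta> where "\<beta> l = Var 5 * Const (coef (cs ! l) ?x) - Var 3 * (Const (coef (cs ! l) ?y) :: (6, 'k) mpol)" for l
  have \<beta>_lin: "(\<Sum>l<length cs. \<beta> l * c l) = Var 5 * (\<Sum>l<length cs. Const (coef (cs ! l) ?x) * c l) -
      Var 3 * (\<Sum>l<length cs. Const (coef (cs ! l) ?y) * c l)" for c
    by (simp add: \<beta>_def sum_distrib_left algebra_simps flip: sum_subtractf)
  have J_eq: "J = {f. supp f \<subseteq> ci_exponents d1 d2 d3}"
    by (simp add: J_def monomial_ci_ideal_def ideal_gen_Var_powers)
  note coefs_basis = basis_of_piece_coefs[OF up_closed_ci_exponents J_eq cs]
  \<comment> \<open>\<open>p\<close> and \<open>q\<close> are the coordinates of the monomials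
    \<open>?z\<close> and \<open>?x\<close>. Against the first functional and \<open>\<beta>\<close>
    they pair to 1 and 0, respectively 0 and \<open>Var 5\<close>.\<close>
  obtain p where p: "\<And>m'. m' \<notin> ci_exponents d1 d2 d3 \<Longrightarrow> (\<Sum>l<length cs. p l * coef (cs ! l) m') = (1 when ?z = m')"
    using coefs_basis[OF deg(1)] by blast
  obtain q where q: "\<And>m'. m' \<notin> ci_exponents d1 d2 d3 \<Longrightarrow> (\<Sum>l<length cs. q l * coef (cs ! l) m') = (1 when ?x = m')"
    using coefs_basis[OF deg(2)] by blast
  have Const_comb: "(\<Sum>l<length cs. Const (coef (cs ! l) m) * Const (r l)) =
      (Const (\<Sum>l<length cs. r l * coef (cs ! l) m) :: (6, 'k) mpol)" for r m
    by (simp add: Const_sum Const_hom mult.commute)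
  have neq: "?z \<noteq> ?x" "?z \<noteq> ?y" "?x \<noteq> ?y"
  proof -
    have "Poly_Mapping.lookup ?z 1 \<noteq> Poly_Mapping.lookup ?x 1" "Poly_Mapping.lookup ?z 2 \<noteq> Poly_Mapping.lookup ?y 2"
      "Poly_Mapping.lookup ?x 1 \<noteq> Poly_Mapping.lookup ?y 1"
      by (simp_all add: lookup_add lookup_single)
    then show "?z \<noteq> ?x" "?z \<noteq> ?y" "?x \<noteq> ?y" by metis+
  qed
  have when_neq: "(1 when ?z = ?x) = (0 :: 'k)" "(1 when ?z = ?y) = (0 :: 'k)"
      "(1 when ?x = ?z) = (0 :: 'k)" "(1 when ?x = ?y) = (0 :: 'k)"
    unfolding when_def by (simp_all only: neq neq[symmetric] if_False)
  \<comment> \<open>Hence a maximal minor omits at most one row.\<close>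
  have len: "length cs \<le> length bs + 1"
    using card_std_exponents[of d3 d1 d2 "n + 1"] d length_basis_of_piece_ci[OF _ _ _ bs[unfolded J_def]]
      length_basis_of_piece_ci[OF _ _ _ cs[unfolded J_def]]
    by (simp add: eval_nat_numeral)
  fix f assume "f \<in> maximal_minors M"
  then obtain rs cols where f: "f = det (submatrix M rs cols)" and sub: "rs \<subseteq> {..<length cs}" "cols \<subseteq> {..<length bs}"
    and card: "card rs = min (length cs) (length bs)" "card cols = min (length cs) (length bs)"
    using Mc unfolding maximal_minors_def by auto
  have "det (submatrix (map_mat ?h M) rs cols) = 0"
  proof (rule det_submatrix_eq_0_two_null_vectors)
    show "map_mat ?h M \<in> carrier_mat (length cs) (length bs)" using Mc by simp
    show "length cs \<le> card rs + 1" using len card by simp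
    show "(\<Sum>l<length cs. Const (coef (cs ! l) ?z) * map_mat ?h M $$ (l, j)) = 0" if "j < length bs" for j
      by (rule row_z[OF that])
    show "(\<Sum>l<length cs. \<beta> l * map_mat ?h M $$ (l, j)) = 0" if "j < length bs" for j
      unfolding \<beta>_lin row_x[OF that] row_y[OF that] by simp
    show "(\<Sum>l<length cs. Const (p l) * Const (coef (cs ! l) ?z)) = (1 :: (6, 'k) mpol)"
      unfolding mult.commute[of "Const (p _)"] Const_comb p[OF std(1)] by (simp add: Const_1)
    show "(\<Sum>l<length cs. Const (q l) * Const (coef (cs ! l) ?z)) = (0 :: (6, 'k) mpol)"
      unfolding mult.commute[of "Const (q _)"] Const_comb q[OF std(1)] when_neq by (rule Const_hom(3))
    have comm: "(\<Sum>l<length cs. c l * \<beta> l) = (\<Sum>l<length cs. \<beta> l * c l)" for c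
      by (simp add: mult.commute)
    show "(\<Sum>l<length cs. Const (p l) * \<beta> l) = 0"
      unfolding comm \<beta>_lin Const_comb p[OF std(2)] p[OF std(3)] when_neq Const_hom(3) by simp
    have "(\<Sum>l<length cs. Const (q l) * \<beta> l) = Var 5"
      unfolding comm \<beta>_lin Const_comb q[OF std(2)] q[OF std(3)] when_neq Const_hom(3) by (simp add: Const_1)
    then show "(\<Sum>l<length cs. Const (q l) * \<beta> l) \<noteq> 0"
      by (simp add: Var_def flip: keys_eq_empty)
  qed (use sub card in auto)
  then have "?h f = 0" using map_mat_submatrix[OF Mc sub, of ?h] hom_det[of "submatrix M rs cols"] f by simp
  then show "f \<in> hyperplane 6" by (simp add: mem_hyperplane_iff)
qed

text \<open>The power \<open>x3^i\<close> is nonzero in \<open>A\<close>. The purpose is to place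
  the degree of \<open>conic_minors_hyperplane\<close> among those over which
  \<open>conic_ideal\<close> intersects.\<close>

lemma le_socle_degree_ci:
  fixes d1 d2 d3 :: nat
  defines "J \<equiv> monomial_ci_ideal d1 d2 d3 :: (3, 'k::field) mpol set"
  assumes "0 < d1" "0 < d2" "i < d3"
  shows "i \<le> socle_degree J"
proof -
  have id: "ideal J typ_ring" unfolding J_def monomial_ci_ideal_def by (rule ideal_ideal_gen)
  have J_eq: "J = {f. supp f \<subseteq> ci_exponents d1 d2 d3}"
    by (simp add: J_def monomial_ci_ideal_def ideal_gen_Var_powers)
  have zero: "residue_class J f = \<zero>\<^bsub>quot_alg J\<^esub> \<longleftrightarrow> supp f \<subseteq> ci_exponents d1 d2 d3" for f
    unfolding residue_class_simps(4)[OF id] residue_class_eq_iff[OF id] by (simp add: J_eq)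
  have "residue_class J (trm (expo 3 i) 1) \<in> graded_piece J i"
    unfolding graded_piece_def by (rule imageI) (simp add: homogeneous_def)
  moreover have "residue_class J (trm (expo 3 i) 1) \<noteq> \<zero>\<^bsub>quot_alg J\<^esub>"
    unfolding zero using assms by (simp add: ci_exponents_def lookup_single)
  ultimately have "graded_piece J i \<noteq> {\<zero>\<^bsub>quot_alg J\<^esub>}" by blast
  \<comment> \<open>A crude bound suffices: it only ensures that the maximum defining
    \<open>socle_degree\<close> exists.\<close>
  moreover have "k \<le> d1 + d2 + d3" if k: "graded_piece J k \<noteq> {\<zero>\<^bsub>quot_alg J\<^esub>}" for k
  proof (rule ccontr)
    assume "\<not> k \<le> d1 + d2 + d3"
    then have "residue_class J f = \<zero>\<^bsub>quot_alg J\<^esub>" if "homogeneous k f" for f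
      using that unfolding zero by (fastforce simp: homogeneous_def ci_exponents_def mdeg_3)
    moreover have "homogeneous k (0 :: (3, 'k) mpol)" by (simp add: homogeneous_def)
    ultimately have "graded_piece J k = {\<zero>\<^bsub>quot_alg J\<^esub>}" unfolding graded_piece_def by blast
    then show False using k by simp
  qed
  ultimately show ?thesis unfolding socle_degree_def by (intro Greatest_le_nat[where b="d1 + d2 + d3"]) auto
qed

theorem proposition7p1:
  fixes d1 d2 d3 :: nat
    and J :: "(3, 'k::{alg_closed_field, field_char_0}) mpol set"
  assumes "2 \<le> d1" and "d1 \<le> d2" and "d3 = d1 + d2"
    and "J = monomial_ci_ideal d1 d2 d3"
  shows "codimension (proj_topology :: (6, 'k) mpol set topology) (non_lefschetz_conics J) = 1"
proof -
  let ?I = "{i. i + 2 \<le> socle_degree J}"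
  \<comment> \<open>\<open>d3\<close> is at least 4, so \<open>n = d3 - 4\<close> is a true
    difference and \<open>n + 1\<close> is the critical source degree \<open>d3 - 3\<close>.\<close>
  have "d3 - 4 + 4 = d3" using assms(1-3) by linarith
  then obtain n where n: "n + 4 = d3" ..
  have "conic_ideal_at J (n + 1) \<subseteq> hyperplane 6"
    unfolding conic_ideal_at_def
  proof (rule ideal_gen_minimal[OF ideal_hyperplane], rule Union_least, clarify)
    fix M bs cs x
    assume "basis_of_piece J (n + 1) bs" "basis_of_piece J (n + 1 + 2) cs" "represents_conic J bs cs M"
      and x: "x \<in> maximal_minors M"
    then have "maximal_minors M \<subseteq> hyperplane 6"
      using assms n by (intro conic_minors_hyperplane[of d1 d2 d3 n bs cs M]) (simp_all add: numeral_3_eq_3)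
    then show "x \<in> hyperplane 6" using x by blast
  qed
  moreover have "n + 1 + 2 \<le> socle_degree J"
    unfolding assms(4) using assms n by (intro le_socle_degree_ci) auto
  ultimately have sub: "conic_ideal J \<subseteq> hyperplane 6" unfolding conic_ideal_def by blast
  have "\<forall>i. \<exists>f. f \<in> conic_ideal_at J i \<and> f \<noteq> 0"
    unfolding assms(4) using conic_ideal_at_nonzero[OF assms(3)] by blast
  then obtain F where F: "\<forall>i. F i \<in> conic_ideal_at J i \<and> F i \<noteq> 0" by (rule choice[THEN exE])
  have fin: "finite ?I" by (rule finite_subset[of _ "{..socle_degree J}"]) auto
  \<comment> \<open>For each \<open>k\<close> the product is a multiple of its factor
    \<open>F k\<close>, hence lies in the \<open>k\<close>-th ideal.\<close>
  have "(\<Prod>i\<in>?I. F i) \<in> conic_ideal_at J k" if k: "k \<in> ?I" for k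
  proof -
    have "(\<Prod>i\<in>?I. F i) = (\<Prod>i\<in>?I - {k}. F i) * F k"
      unfolding prod.remove[OF fin k] by (rule mult.commute)
    also have "\<dots> \<in> conic_ideal_at J k"
      using F unfolding conic_ideal_at_def by (intro ideal_typ_ringD(3)[OF ideal_ideal_gen]) blast
    finally show ?thesis .
  qed
  then have mem: "(\<Prod>i\<in>?I. F i) \<in> conic_ideal J" unfolding conic_ideal_def by (rule INT_I)
  have nz: "(\<Prod>i\<in>?I. F i) \<noteq> 0" unfolding prod_zero_iff[OF fin] using F by blast
  have "(1 :: 6) \<noteq> 6" by simp
  from codimension_eq_1[OF sub this mem nz] show ?thesis unfolding non_lefschetz_conics_def .
qed

end
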